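(* Let $\mathbf{k}$ be a field and consider persistence modules over $(\mathbb{R}^n,\le)$ with values in $\mathbf{k}$-vector spaces. Let $M$ be a persistence module. Then $-\otimes_{\mathbf{sh}} M$ and $M\otimes_{\mathbf{sh}} -$ are exact functors. In particular, $\mathbf{Tor}_i^{\mathbf{sh}}(M,N)=0$ for any persistence modules $M$ and $N$ and any $i\ge 1$.
   Context: $\mathbb{R}^n$ has the product partial order. A persistence module is a functor from the poset $(\mathbb{R}^n,\le)$ to $\mathbf{k}$-vector spaces; equivalently, a sheaf of $\mathbf{k}$-vector spaces on $\mathbb{R}^n$ with the Alexandrov topology (open sets are the up-sets), i.e. a module over the constant sheaf $\mathbf{k}_{\mathbb{R}^n}$; the functor is recovered by $M_a=M(U_a)$, the stalk at $a$, where $U_a=\{x: a\le x\}$. The sheaf tensor product $M\otimes_{\mathbf{sh}}N$ is the tensor product over $\mathbf{k}_{\mathbb{R}^n}$; as a functor it is given by $(M\otimes_{\mathbf{sh}}N)_a=M_a\otimes_{\mathbf{k}}N_a$ with the induced maps. $\mathbf{Tor}^{\mathbf{sh}}_i$ is the $i$-th left derived functor of $\otimes_{\mathbf{sh}}$. *)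

theory Defs
  imports "HOL-Analysis.Finite_Cartesian_Product" "HOL-Algebra.Module" "HOL-Algebra.AbelCoset"
begin

text \<open>Vector spaces over a field \<open>k\<close> are HOL-Algebra modules over \<open>k\<close>. The record fields
  \<open>mult\<close> and \<open>one\<close> of a module carry no meaning.\<close>

definition linear_map ::
  "'k ring \<Rightarrow> ('k, 'v) module \<Rightarrow> ('k, 'w) module \<Rightarrow> ('v \<Rightarrow> 'w) \<Rightarrow> bool" where
  "linear_map k V W f \<longleftrightarrow>
     f \<in> carrier V \<rightarrow> carrier W \<and>
     (\<forall>x\<in>carrier V. \<forall>y\<in>carrier V. f (x \<oplus>\<^bsub>V\<^esub> y) = f x \<oplus>\<^bsub>W\<^esub> f y) \<and>
     (\<forall>c\<in>carrier k. \<forall>x\<in>carrier V. f (c \<odot>\<^bsub>V\<^esub> x) = c \<odot>\<^bsub>W\<^esub> f x)"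

definition quotient_module ::
  "'k ring \<Rightarrow> ('k, 'v) module \<Rightarrow> 'v set \<Rightarrow> ('k, 'v set) module" where
  "quotient_module k V H =
     \<lparr>carrier = a_rcosets\<^bsub>V\<^esub> H, mult = (\<lambda>_ _. H), one = H, zero = H, add = set_add V,
      smult = (\<lambda>c X. \<Union>x\<in>X. H +>\<^bsub>V\<^esub> (c \<odot>\<^bsub>V\<^esub> x))\<rparr>"

definition module_span :: "'k ring \<Rightarrow> ('k, 'v) module \<Rightarrow> 'v set \<Rightarrow> 'v set" where
  "module_span k V S = \<Inter>{H. submodule H k V \<and> S \<subseteq> H}"

text \<open>The free module on \<open>S\<close>: finitely supported functions \<open>S \<rightarrow> k\<close>, extended by zero.\<close>

definition free_module :: "'k ring \<Rightarrow> 's set \<Rightarrow> ('k, 's \<Rightarrow> 'k) module" where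
  "free_module k S =
     \<lparr>carrier = {\<phi>. range \<phi> \<subseteq> carrier k \<and> {s. \<phi> s \<noteq> \<zero>\<^bsub>k\<^esub>} \<subseteq> S \<and> finite {s. \<phi> s \<noteq> \<zero>\<^bsub>k\<^esub>}},
      mult = (\<lambda>_ _ _. \<zero>\<^bsub>k\<^esub>), one = (\<lambda>_. \<zero>\<^bsub>k\<^esub>), zero = (\<lambda>_. \<zero>\<^bsub>k\<^esub>),
      add = (\<lambda>\<phi> \<psi> s. \<phi> s \<oplus>\<^bsub>k\<^esub> \<psi> s),
      smult = (\<lambda>c \<phi> s. c \<otimes>\<^bsub>k\<^esub> \<phi> s)\<rparr>"

definition free_gen :: "'k ring \<Rightarrow> 's \<Rightarrow> 's \<Rightarrow> 'k" where
  "free_gen k s = (\<lambda>t. if t = s then \<one>\<^bsub>k\<^esub> else \<zero>\<^bsub>k\<^esub>)"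

text \<open>The tensor product over \<open>k\<close>: the free module on pairs modulo the bilinearity relations.\<close>

definition tensor_free ::
  "'k ring \<Rightarrow> ('k, 'v) module \<Rightarrow> ('k, 'w) module \<Rightarrow> ('k, 'v \<times> 'w \<Rightarrow> 'k) module" where
  "tensor_free k V W = free_module k (carrier V \<times> carrier W)"

definition tensor_relations ::
  "'k ring \<Rightarrow> ('k, 'v) module \<Rightarrow> ('k, 'w) module \<Rightarrow> ('v \<times> 'w \<Rightarrow> 'k) set" where
  "tensor_relations k V W =
     {free_gen k (x \<oplus>\<^bsub>V\<^esub> x', y) \<ominus>\<^bsub>tensor_free k V W\<^esub>
        (free_gen k (x, y) \<oplus>\<^bsub>tensor_free k V W\<^esub> free_gen k (x', y)) | x x' y.
        x \<in> carrier V \<and> x' \<in> carrier V \<and> y \<in> carrier W} \<union>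
     {free_gen k (x, y \<oplus>\<^bsub>W\<^esub> y') \<ominus>\<^bsub>tensor_free k V W\<^esub>
        (free_gen k (x, y) \<oplus>\<^bsub>tensor_free k V W\<^esub> free_gen k (x, y')) | x y y'.
        x \<in> carrier V \<and> y \<in> carrier W \<and> y' \<in> carrier W} \<union>
     {free_gen k (c \<odot>\<^bsub>V\<^esub> x, y) \<ominus>\<^bsub>tensor_free k V W\<^esub>
        (c \<odot>\<^bsub>tensor_free k V W\<^esub> free_gen k (x, y)) | c x y.
        c \<in> carrier k \<and> x \<in> carrier V \<and> y \<in> carrier W} \<union>
     {free_gen k (x, c \<odot>\<^bsub>W\<^esub> y) \<ominus>\<^bsub>tensor_free k V W\<^esub>
        (c \<odot>\<^bsub>tensor_free k V W\<^esub> free_gen k (x, y)) | c x y.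
        c \<in> carrier k \<and> x \<in> carrier V \<and> y \<in> carrier W}"

definition tensor_kernel ::
  "'k ring \<Rightarrow> ('k, 'v) module \<Rightarrow> ('k, 'w) module \<Rightarrow> ('v \<times> 'w \<Rightarrow> 'k) set" where
  "tensor_kernel k V W = module_span k (tensor_free k V W) (tensor_relations k V W)"

definition tensor_module ::
  "'k ring \<Rightarrow> ('k, 'v) module \<Rightarrow> ('k, 'w) module \<Rightarrow> ('k, ('v \<times> 'w \<Rightarrow> 'k) set) module" where
  "tensor_module k V W = quotient_module k (tensor_free k V W) (tensor_kernel k V W)"

text \<open>The linear extension of a map between generating sets, on free modules.\<close>

definition free_push :: "'k ring \<Rightarrow> ('s \<Rightarrow> 't) \<Rightarrow> ('s \<Rightarrow> 'k) \<Rightarrow> 't \<Rightarrow> 'k" where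
  "free_push k h \<phi> t = (\<Oplus>\<^bsub>k\<^esub>s\<in>{s. \<phi> s \<noteq> \<zero>\<^bsub>k\<^esub> \<and> h s = t}. \<phi> s)"

text \<open>The induced map \<open>f \<otimes> g : V \<otimes> W \<rightarrow> V' \<otimes> W'\<close> on cosets; only the target enters explicitly.\<close>

definition tensor_map ::
  "'k ring \<Rightarrow> ('k, 'v2) module \<Rightarrow> ('k, 'w2) module \<Rightarrow> ('v \<Rightarrow> 'v2) \<Rightarrow> ('w \<Rightarrow> 'w2) \<Rightarrow>
    ('v \<times> 'w \<Rightarrow> 'k) set \<Rightarrow> ('v2 \<times> 'w2 \<Rightarrow> 'k) set" where
  "tensor_map k V' W' f g X =
     (\<Union>\<phi>\<in>X. tensor_kernel k V' W' +>\<^bsub>tensor_free k V' W'\<^esub> free_push k (map_prod f g) \<phi>)"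

subsection \<open>Persistence modules\<close>

text \<open>A persistence module over a poset as a functor to vector spaces. For the Alexandrov sheaf \<open>M\<close>,
  \<open>stalk M a\<close> is \<open>M(U\<^sub>a)\<close>, and \<open>res M a b\<close> for \<open>a \<le> b\<close> is the restriction \<open>M(U\<^sub>a) \<rightarrow> M(U\<^sub>b)\<close>; the
  values \<open>res M a b\<close> with \<open>\<not> a \<le> b\<close> carry no meaning. The underlying sets of all the stalks lie in
  one type \<open>'u\<close>, which plays the role of a universe: the modules with stalks in \<open>'u\<close> form a category.
  It has enough projectives as soon as \<open>'u\<close> is closed under forming free modules; see
  \<open>projective_resolution_exists\<close> below.\<close>

record ('i, 'k, 'u) pmod =
  stalk :: "'i \<Rightarrow> ('k, 'u) module"
  res :: "'i \<Rightarrow> 'i \<Rightarrow> 'u \<Rightarrow> 'u"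

definition persistence_module :: "'k ring \<Rightarrow> ('i::order, 'k, 'u) pmod \<Rightarrow> bool" where
  "persistence_module k M \<longleftrightarrow>
     (\<forall>a. Module.module k (stalk M a)) \<and>
     (\<forall>a b. a \<le> b \<longrightarrow> linear_map k (stalk M a) (stalk M b) (res M a b)) \<and>
     (\<forall>a. \<forall>x\<in>carrier (stalk M a). res M a a x = x) \<and>
     (\<forall>a b c. a \<le> b \<longrightarrow> b \<le> c \<longrightarrow>
        (\<forall>x\<in>carrier (stalk M a). res M b c (res M a b x) = res M a c x))"

definition zero_pmod :: "('i, 'k, 'u) pmod \<Rightarrow> bool" where
  "zero_pmod M \<longleftrightarrow> (\<forall>a. carrier (stalk M a) = {\<zero>\<^bsub>stalk M a\<^esub>})"

definition pmorphism ::
  "'k ring \<Rightarrow> ('i::order, 'k, 'u) pmod \<Rightarrow> ('i, 'k, 'v) pmod \<Rightarrow> ('i \<Rightarrow> 'u \<Rightarrow> 'v) \<Rightarrow> bool" where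
  "pmorphism k M N f \<longleftrightarrow>
     (\<forall>a. linear_map k (stalk M a) (stalk N a) (f a)) \<and>
     (\<forall>a b. a \<le> b \<longrightarrow> (\<forall>x\<in>carrier (stalk M a). f b (res M a b x) = res N a b (f a x)))"

text \<open>Morphisms with source \<open>M\<close> are identified when they agree on the stalks of \<open>M\<close>.\<close>

definition pmorphism_eq ::
  "('i, 'k, 'u) pmod \<Rightarrow> ('i \<Rightarrow> 'u \<Rightarrow> 'v) \<Rightarrow> ('i \<Rightarrow> 'u \<Rightarrow> 'v) \<Rightarrow> bool" where
  "pmorphism_eq M f g \<longleftrightarrow> (\<forall>a. \<forall>x\<in>carrier (stalk M a). f a x = g a x)"

definition pid :: "'i \<Rightarrow> 'u \<Rightarrow> 'u" where
  "pid = (\<lambda>a x. x)"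

definition pcomp :: "('i \<Rightarrow> 'v \<Rightarrow> 'w) \<Rightarrow> ('i \<Rightarrow> 'u \<Rightarrow> 'v) \<Rightarrow> 'i \<Rightarrow> 'u \<Rightarrow> 'w" where
  "pcomp g f = (\<lambda>a x. g a (f a x))"

definition padd ::
  "('i, 'k, 'v) pmod \<Rightarrow> ('i \<Rightarrow> 'u \<Rightarrow> 'v) \<Rightarrow> ('i \<Rightarrow> 'u \<Rightarrow> 'v) \<Rightarrow> 'i \<Rightarrow> 'u \<Rightarrow> 'v" where
  "padd N f g = (\<lambda>a x. f a x \<oplus>\<^bsub>stalk N a\<^esub> g a x)"

text \<open>Kernels and images, hence exactness, of persistence modules are computed at each stalk.\<close>

definition pmono :: "('i, 'k, 'u) pmod \<Rightarrow> ('i \<Rightarrow> 'u \<Rightarrow> 'v) \<Rightarrow> bool" where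
  "pmono M f \<longleftrightarrow> (\<forall>a. inj_on (f a) (carrier (stalk M a)))"

definition pepi ::
  "('i, 'k, 'u) pmod \<Rightarrow> ('i, 'k, 'v) pmod \<Rightarrow> ('i \<Rightarrow> 'u \<Rightarrow> 'v) \<Rightarrow> bool" where
  "pepi M N f \<longleftrightarrow> (\<forall>a. f a ` carrier (stalk M a) = carrier (stalk N a))"

definition exact_at ::
  "('i, 'k, 'u) pmod \<Rightarrow> ('i \<Rightarrow> 'u \<Rightarrow> 'v) \<Rightarrow> ('i, 'k, 'v) pmod \<Rightarrow> ('i \<Rightarrow> 'v \<Rightarrow> 'w) \<Rightarrow>
    ('i, 'k, 'w) pmod \<Rightarrow> bool" where
  "exact_at A f B g C \<longleftrightarrow>
     (\<forall>a. f a ` carrier (stalk A a) = {x \<in> carrier (stalk B a). g a x = \<zero>\<^bsub>stalk C a\<^esub>})"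

definition short_exact ::
  "'k ring \<Rightarrow> ('i::order, 'k, 'u) pmod \<Rightarrow> ('i \<Rightarrow> 'u \<Rightarrow> 'v) \<Rightarrow> ('i, 'k, 'v) pmod \<Rightarrow>
    ('i \<Rightarrow> 'v \<Rightarrow> 'w) \<Rightarrow> ('i, 'k, 'w) pmod \<Rightarrow> bool" where
  "short_exact k A f B g C \<longleftrightarrow>
     persistence_module k A \<and> persistence_module k B \<and> persistence_module k C \<and>
     pmorphism k A B f \<and> pmorphism k B C g \<and> pmono A f \<and> exact_at A f B g C \<and> pepi B C g"

subsection \<open>Functors and exactness\<close>

text \<open>A functor from the persistence modules with stalks in \<open>'u\<close> to those with stalks in \<open>'w\<close> is a
  pair of an action \<open>Fo\<close> on objects and an action \<open>Fm\<close> on morphisms; \<open>Fm A B f\<close> is the image of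
  \<open>f : A \<rightarrow> B\<close>.\<close>

definition is_functor ::
  "'k ring \<Rightarrow> (('i::order, 'k, 'u) pmod \<Rightarrow> ('i, 'k, 'w) pmod) \<Rightarrow>
    (('i, 'k, 'u) pmod \<Rightarrow> ('i, 'k, 'u) pmod \<Rightarrow> ('i \<Rightarrow> 'u \<Rightarrow> 'u) \<Rightarrow> 'i \<Rightarrow> 'w \<Rightarrow> 'w) \<Rightarrow> bool" where
  "is_functor k Fo Fm \<longleftrightarrow>
     (\<forall>A. persistence_module k A \<longrightarrow> persistence_module k (Fo A)) \<and>
     (\<forall>A B f. persistence_module k A \<longrightarrow> persistence_module k B \<longrightarrow> pmorphism k A B f \<longrightarrow>
        pmorphism k (Fo A) (Fo B) (Fm A B f)) \<and>
     (\<forall>A B f g. persistence_module k A \<longrightarrow> persistence_module k B \<longrightarrow>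
        pmorphism k A B f \<longrightarrow> pmorphism k A B g \<longrightarrow> pmorphism_eq A f g \<longrightarrow>
        pmorphism_eq (Fo A) (Fm A B f) (Fm A B g)) \<and>
     (\<forall>A. persistence_module k A \<longrightarrow> pmorphism_eq (Fo A) (Fm A A pid) pid) \<and>
     (\<forall>A B C f g. persistence_module k A \<longrightarrow> persistence_module k B \<longrightarrow> persistence_module k C \<longrightarrow>
        pmorphism k A B f \<longrightarrow> pmorphism k B C g \<longrightarrow>
        pmorphism_eq (Fo A) (Fm A C (pcomp g f)) (pcomp (Fm B C g) (Fm A B f)))"

definition additive_functor ::
  "'k ring \<Rightarrow> (('i::order, 'k, 'u) pmod \<Rightarrow> ('i, 'k, 'w) pmod) \<Rightarrow>
    (('i, 'k, 'u) pmod \<Rightarrow> ('i, 'k, 'u) pmod \<Rightarrow> ('i \<Rightarrow> 'u \<Rightarrow> 'u) \<Rightarrow> 'i \<Rightarrow> 'w \<Rightarrow> 'w) \<Rightarrow> bool" where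
  "additive_functor k Fo Fm \<longleftrightarrow>
     is_functor k Fo Fm \<and>
     (\<forall>A B f g. persistence_module k A \<longrightarrow> persistence_module k B \<longrightarrow>
        pmorphism k A B f \<longrightarrow> pmorphism k A B g \<longrightarrow>
        pmorphism_eq (Fo A) (Fm A B (padd B f g)) (padd (Fo B) (Fm A B f) (Fm A B g)))"

definition exact_functor ::
  "'k ring \<Rightarrow> (('i::order, 'k, 'u) pmod \<Rightarrow> ('i, 'k, 'w) pmod) \<Rightarrow>
    (('i, 'k, 'u) pmod \<Rightarrow> ('i, 'k, 'u) pmod \<Rightarrow> ('i \<Rightarrow> 'u \<Rightarrow> 'u) \<Rightarrow> 'i \<Rightarrow> 'w \<Rightarrow> 'w) \<Rightarrow> bool" where
  "exact_functor k Fo Fm \<longleftrightarrow>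
     additive_functor k Fo Fm \<and>
     (\<forall>A f B g C. short_exact k A f B g C \<longrightarrow>
        short_exact k (Fo A) (Fm A B f) (Fo B) (Fm B C g) (Fo C))"

subsection \<open>Left derived functors\<close>

definition projective :: "'k ring \<Rightarrow> ('i::order, 'k, 'u) pmod \<Rightarrow> bool" where
  "projective k P \<longleftrightarrow>
     persistence_module k P \<and>
     (\<forall>(A :: ('i, 'k, 'u) pmod) (B :: ('i, 'k, 'u) pmod) g f.
        persistence_module k A \<longrightarrow> persistence_module k B \<longrightarrow>
        pmorphism k A B g \<longrightarrow> pepi A B g \<longrightarrow> pmorphism k P B f \<longrightarrow>
        (\<exists>h. pmorphism k P A h \<and> pmorphism_eq P (pcomp g h) f))"

text \<open>\<open>d i : P (Suc i) \<rightarrow> P i\<close> are the differentials, \<open>e : P 0 \<rightarrow> M\<close> is the augmentation.\<close>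

definition projective_resolution ::
  "'k ring \<Rightarrow> (nat \<Rightarrow> ('i::order, 'k, 'u) pmod) \<Rightarrow> (nat \<Rightarrow> 'i \<Rightarrow> 'u \<Rightarrow> 'u) \<Rightarrow>
    ('i \<Rightarrow> 'u \<Rightarrow> 'u) \<Rightarrow> ('i, 'k, 'u) pmod \<Rightarrow> bool" where
  "projective_resolution k P d e M \<longleftrightarrow>
     (\<forall>i. projective k (P i)) \<and>
     (\<forall>i. pmorphism k (P (Suc i)) (P i) (d i)) \<and>
     pmorphism k (P 0) M e \<and>
     pepi (P 0) M e \<and>
     exact_at (P (Suc 0)) (d 0) (P 0) e M \<and>
     (\<forall>i. exact_at (P (Suc (Suc i))) (d (Suc i)) (P (Suc i)) (d i) (P i))"

definition cycles ::
  "(nat \<Rightarrow> ('i, 'k, 'u) pmod) \<Rightarrow> (nat \<Rightarrow> 'i \<Rightarrow> 'u \<Rightarrow> 'u) \<Rightarrow> nat \<Rightarrow> 'i \<Rightarrow> 'u set" where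
  "cycles C d i a = {x \<in> carrier (stalk (C i) a).
     case i of 0 \<Rightarrow> True | Suc j \<Rightarrow> d j a x = \<zero>\<^bsub>stalk (C j) a\<^esub>}"

definition boundaries ::
  "(nat \<Rightarrow> ('i, 'k, 'u) pmod) \<Rightarrow> (nat \<Rightarrow> 'i \<Rightarrow> 'u \<Rightarrow> 'u) \<Rightarrow> nat \<Rightarrow> 'i \<Rightarrow> 'u set" where
  "boundaries C d i a = d i a ` carrier (stalk (C (Suc i)) a)"

definition homology ::
  "'k ring \<Rightarrow> (nat \<Rightarrow> ('i, 'k, 'u) pmod) \<Rightarrow> (nat \<Rightarrow> 'i \<Rightarrow> 'u \<Rightarrow> 'u) \<Rightarrow> nat \<Rightarrow>
    ('i, 'k, 'u set) pmod" where
  "homology k C d i =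
     \<lparr>stalk = (\<lambda>a. quotient_module k ((stalk (C i) a)\<lparr>carrier := cycles C d i a\<rparr>)
                (boundaries C d i a)),
      res = (\<lambda>a b X. \<Union>x\<in>X. boundaries C d i b +>\<^bsub>stalk (C i) b\<^esub> res (C i) a b x)\<rparr>"

text \<open>The \<open>i\<close>-th left derived functor of \<open>F\<close> at \<open>M\<close> is determined up to isomorphism only; we take the
  set of all of its models \<open>H\<^sub>i(F(P))\<close>, for \<open>P\<close> a projective resolution of \<open>M\<close>.\<close>

definition left_derived ::
  "'k ring \<Rightarrow> (('i::order, 'k, 'u) pmod \<Rightarrow> ('i, 'k, 'w) pmod) \<Rightarrow>
    (('i, 'k, 'u) pmod \<Rightarrow> ('i, 'k, 'u) pmod \<Rightarrow> ('i \<Rightarrow> 'u \<Rightarrow> 'u) \<Rightarrow> 'i \<Rightarrow> 'w \<Rightarrow> 'w) \<Rightarrow>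
    nat \<Rightarrow> ('i, 'k, 'u) pmod \<Rightarrow> ('i, 'k, 'w set) pmod set" where
  "left_derived k Fo Fm i M =
     {homology k (\<lambda>j. Fo (P j)) (\<lambda>j. Fm (P (Suc j)) (P j) (d j)) i | P d e.
        projective_resolution k P d e M}"

subsection \<open>The sheaf tensor product and Tor\<close>

definition tensor_pmod ::
  "'k ring \<Rightarrow> ('i, 'k, 'u) pmod \<Rightarrow> ('i, 'k, 'v) pmod \<Rightarrow> ('i, 'k, ('u \<times> 'v \<Rightarrow> 'k) set) pmod" where
  "tensor_pmod k M N =
     \<lparr>stalk = (\<lambda>a. tensor_module k (stalk M a) (stalk N a)),
      res = (\<lambda>a b. tensor_map k (stalk M b) (stalk N b) (res M a b) (res N a b))\<rparr>"

text \<open>\<open>f \<otimes> g : M \<otimes> N \<rightarrow> M' \<otimes> N'\<close>\<close>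

definition tensor_pmor ::
  "'k ring \<Rightarrow> ('i, 'k, 'u2) pmod \<Rightarrow> ('i, 'k, 'v2) pmod \<Rightarrow> ('i \<Rightarrow> 'u \<Rightarrow> 'u2) \<Rightarrow> ('i \<Rightarrow> 'v \<Rightarrow> 'v2) \<Rightarrow>
    'i \<Rightarrow> ('u \<times> 'v \<Rightarrow> 'k) set \<Rightarrow> ('u2 \<times> 'v2 \<Rightarrow> 'k) set" where
  "tensor_pmor k M' N' f g = (\<lambda>a. tensor_map k (stalk M' a) (stalk N' a) (f a) (g a))"

definition Tor ::
  "'k ring \<Rightarrow> nat \<Rightarrow> ('i::order, 'k, 'u) pmod \<Rightarrow> ('i, 'k, 'v) pmod \<Rightarrow>
    ('i, 'k, ('u \<times> 'v \<Rightarrow> 'k) set set) pmod set" where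
  "Tor k i M N =
     left_derived k (\<lambda>A. tensor_pmod k A N) (\<lambda>A B f. tensor_pmor k B N f pid) i M"

text \<open>Tor computed by resolving the second argument instead of the first.\<close>

definition Tor' ::
  "'k ring \<Rightarrow> nat \<Rightarrow> ('i::order, 'k, 'u) pmod \<Rightarrow> ('i, 'k, 'v) pmod \<Rightarrow>
    ('i, 'k, ('u \<times> 'v \<Rightarrow> 'k) set set) pmod set" where
  "Tor' k i M N =
     left_derived k (\<lambda>A. tensor_pmod k M A) (\<lambda>A B f. tensor_pmor k M B pid f) i N"

subsection \<open>Existence of projective resolutions\<close>

text \<open>This subsection shows that \<open>left_derived\<close>, hence \<open>Tor\<close>, is never empty for a universe that is
  closed under finite lists, such as \<open>universe\<close> below.\<close>

lemma linear_mapD: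
  assumes "linear_map k V W f"
  shows "x \<in> carrier V \<Longrightarrow> f x \<in> carrier W"
    and "x \<in> carrier V \<Longrightarrow> y \<in> carrier V \<Longrightarrow> f (x \<oplus>\<^bsub>V\<^esub> y) = f x \<oplus>\<^bsub>W\<^esub> f y"
    and "c \<in> carrier k \<Longrightarrow> x \<in> carrier V \<Longrightarrow> f (c \<odot>\<^bsub>V\<^esub> x) = c \<odot>\<^bsub>W\<^esub> f x"
  using assms by (auto simp: linear_map_def)

lemma linear_map_comp:
  assumes "linear_map k U V f" "linear_map k V W g"
  shows "linear_map k U W (\<lambda>x. g (f x))"
  unfolding linear_map_def
  by (auto simp: linear_mapD[OF assms(1)] linear_mapD[OF assms(2)])

lemma linear_map_zero:
  assumes "Module.module k V" "Module.module k W" "linear_map k V W f"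
  shows "f \<zero>\<^bsub>V\<^esub> = \<zero>\<^bsub>W\<^esub>"
proof -
  interpret V: Module.module k V by fact
  interpret W: Module.module k W by fact
  have "f (\<zero>\<^bsub>k\<^esub> \<odot>\<^bsub>V\<^esub> \<zero>\<^bsub>V\<^esub>) = \<zero>\<^bsub>k\<^esub> \<odot>\<^bsub>W\<^esub> f \<zero>\<^bsub>V\<^esub>"
    using linear_mapD(3)[OF assms(3)] by blast
  then show ?thesis
    using linear_mapD(1)[OF assms(3)] by simp
qed

lemma free_module_simps:
  "\<zero>\<^bsub>free_module k S\<^esub> = (\<lambda>_. \<zero>\<^bsub>k\<^esub>)"
  "\<phi> \<oplus>\<^bsub>free_module k S\<^esub> \<psi> = (\<lambda>s. \<phi> s \<oplus>\<^bsub>k\<^esub> \<psi> s)"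
  "c \<odot>\<^bsub>free_module k S\<^esub> \<phi> = (\<lambda>s. c \<otimes>\<^bsub>k\<^esub> \<phi> s)"
  by (simp_all add: free_module_def)

lemma free_module_carrier:
  "\<phi> \<in> carrier (free_module k S) \<longleftrightarrow> (\<forall>s. \<phi> s \<in> carrier k) \<and> (\<forall>s. \<phi> s \<noteq> \<zero>\<^bsub>k\<^esub> \<longrightarrow> s \<in> S) \<and>
     finite {s. \<phi> s \<noteq> \<zero>\<^bsub>k\<^esub>}"
  by (auto simp: free_module_def)

lemma module_free_module:
  assumes "cring k"
  shows "Module.module k (free_module k S)"
proof -
  interpret cring k by fact
  let ?F = "free_module k S"
  have add: "\<phi> \<oplus>\<^bsub>?F\<^esub> \<psi> \<in> carrier ?F" if "\<phi> \<in> carrier ?F" "\<psi> \<in> carrier ?F" for \<phi> \<psi>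
  proof -
    have sub: "{s. \<phi> s \<oplus>\<^bsub>k\<^esub> \<psi> s \<noteq> \<zero>\<^bsub>k\<^esub>} \<subseteq> {s. \<phi> s \<noteq> \<zero>\<^bsub>k\<^esub>} \<union> {s. \<psi> s \<noteq> \<zero>\<^bsub>k\<^esub>}" by auto
    from that have "finite ({s. \<phi> s \<noteq> \<zero>\<^bsub>k\<^esub>} \<union> {s. \<psi> s \<noteq> \<zero>\<^bsub>k\<^esub>})" by (simp add: free_module_carrier)
    from finite_subset[OF sub this] that sub show ?thesis
      unfolding free_module_carrier free_module_simps by blast
  qed
  have sm: "c \<odot>\<^bsub>?F\<^esub> \<phi> \<in> carrier ?F" if "c \<in> carrier k" "\<phi> \<in> carrier ?F" for c \<phi>
  proof -
    have sub: "{s. c \<otimes>\<^bsub>k\<^esub> \<phi> s \<noteq> \<zero>\<^bsub>k\<^esub>} \<subseteq> {s. \<phi> s \<noteq> \<zero>\<^bsub>k\<^esub>}" using that by auto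
    then have "finite {s. c \<otimes>\<^bsub>k\<^esub> \<phi> s \<noteq> \<zero>\<^bsub>k\<^esub>}"
      using that finite_subset unfolding free_module_carrier by blast
    with that sub show ?thesis
      unfolding free_module_carrier free_module_simps by blast
  qed
  have zero: "(\<lambda>_. \<zero>\<^bsub>k\<^esub>) \<in> carrier ?F" by (simp add: free_module_carrier)
  have cl: "\<phi> s \<in> carrier k" if "\<phi> \<in> carrier ?F" for \<phi> s
    using that by (simp add: free_module_carrier)
  show ?thesis
  proof (rule moduleI[OF assms])
    show "abelian_group ?F"
    proof (rule abelian_groupI)
      fix \<phi> assume \<phi>: "\<phi> \<in> carrier ?F"
      have "(\<ominus>\<^bsub>k\<^esub> \<one>\<^bsub>k\<^esub>) \<odot>\<^bsub>?F\<^esub> \<phi> \<oplus>\<^bsub>?F\<^esub> \<phi> = \<zero>\<^bsub>?F\<^esub>"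
        using \<phi> unfolding free_module_carrier free_module_simps by (auto simp: l_minus l_neg)
      moreover have "(\<ominus>\<^bsub>k\<^esub> \<one>\<^bsub>k\<^esub>) \<odot>\<^bsub>?F\<^esub> \<phi> \<in> carrier ?F" using sm \<phi> by blast
      ultimately show "\<exists>y\<in>carrier ?F. y \<oplus>\<^bsub>?F\<^esub> \<phi> = \<zero>\<^bsub>?F\<^esub>" by blast
    qed (auto simp: add[unfolded free_module_simps] free_module_simps zero a_assoc cl intro!: ext a_comm)
  qed (auto simp: sm[unfolded free_module_simps] free_module_simps l_distr r_distr m_assoc cl)
qed

lemma free_gen_closed:
  assumes "cring k" "s \<in> S"
  shows "free_gen k s \<in> carrier (free_module k S)"
proof -
  interpret cring k by fact
  show ?thesis using assms
    by (auto simp: free_module_carrier free_gen_def intro!: finite_subset[of _ "{s}"])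
qed

definition free_ext ::
  "('k, 'v) module \<Rightarrow> 'k ring \<Rightarrow> ('s \<Rightarrow> 'v) \<Rightarrow> ('s \<Rightarrow> 'k) \<Rightarrow> 'v" where
  "free_ext W k y \<phi> = (\<Oplus>\<^bsub>W\<^esub>s\<in>{s. \<phi> s \<noteq> \<zero>\<^bsub>k\<^esub>}. \<phi> s \<odot>\<^bsub>W\<^esub> y s)"

lemma free_ext:
  assumes W: "Module.module k W" and y: "\<And>s. s \<in> S \<Longrightarrow> y s \<in> carrier W"
  shows "linear_map k (free_module k S) W (free_ext W k y)"
    and "\<And>s. s \<in> S \<Longrightarrow> free_ext W k y (free_gen k s) = y s"
proof -
  interpret W: Module.module k W by fact
  let ?F = "free_module k S"
  have sub: "free_ext W k y \<phi> = (\<Oplus>\<^bsub>W\<^esub>s\<in>T. \<phi> s \<odot>\<^bsub>W\<^esub> y s)"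
    if "\<phi> \<in> carrier ?F" "finite T" "{s. \<phi> s \<noteq> \<zero>\<^bsub>k\<^esub>} \<subseteq> T" "T \<subseteq> S" for \<phi> T
    unfolding free_ext_def
    using that y by (intro W.add.finprod_mono_neutral_cong_left) (auto simp: free_module_carrier)
  have cl: "(\<Oplus>\<^bsub>W\<^esub>s\<in>T. \<phi> s \<odot>\<^bsub>W\<^esub> y s) \<in> carrier W"
    if "\<phi> \<in> carrier ?F" "T \<subseteq> S" for \<phi> T
    using that y by (intro W.finsum_closed) (auto simp: free_module_carrier)
  interpret F: Module.module k ?F by (rule module_free_module[OF W.R.is_cring])
  show "linear_map k ?F W (free_ext W k y)"
    unfolding linear_map_def
  proof (intro conjI ballI)
    show "free_ext W k y \<in> carrier ?F \<rightarrow> carrier W"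
      unfolding free_ext_def by (intro funcsetI cl) (auto simp: free_module_carrier)
  next
    fix \<phi> \<psi> assume \<phi>: "\<phi> \<in> carrier ?F" and \<psi>: "\<psi> \<in> carrier ?F"
    let ?T = "{s. \<phi> s \<noteq> \<zero>\<^bsub>k\<^esub>} \<union> {s. \<psi> s \<noteq> \<zero>\<^bsub>k\<^esub>}"
    have T: "finite ?T" "?T \<subseteq> S" using \<phi> \<psi> by (auto simp: free_module_carrier)
    have c: "\<phi> s \<in> carrier k" "\<psi> s \<in> carrier k" for s
      using \<phi> \<psi> by (simp_all add: free_module_carrier)
    have yT: "y s \<in> carrier W" if "s \<in> ?T" for s using that T(2) y by blast
    have "free_ext W k y (\<phi> \<oplus>\<^bsub>?F\<^esub> \<psi>) = (\<Oplus>\<^bsub>W\<^esub>s\<in>?T. (\<phi> \<oplus>\<^bsub>?F\<^esub> \<psi>) s \<odot>\<^bsub>W\<^esub> y s)"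
      by (rule sub[OF F.a_closed[OF \<phi> \<psi>] T(1) _ T(2)]) (auto simp: free_module_simps)
    also have "\<dots> = (\<Oplus>\<^bsub>W\<^esub>s\<in>?T. \<phi> s \<odot>\<^bsub>W\<^esub> y s \<oplus>\<^bsub>W\<^esub> \<psi> s \<odot>\<^bsub>W\<^esub> y s)"
    proof (rule W.add.finprod_cong'[OF refl])
      show "(\<phi> \<oplus>\<^bsub>?F\<^esub> \<psi>) s \<odot>\<^bsub>W\<^esub> y s = \<phi> s \<odot>\<^bsub>W\<^esub> y s \<oplus>\<^bsub>W\<^esub> \<psi> s \<odot>\<^bsub>W\<^esub> y s" if "s \<in> ?T" for s
        unfolding free_module_simps by (rule W.smult_l_distr[OF c yT[OF that]])
    qed (use c yT in blast)
    also have "\<dots> = (\<Oplus>\<^bsub>W\<^esub>s\<in>?T. \<phi> s \<odot>\<^bsub>W\<^esub> y s) \<oplus>\<^bsub>W\<^esub> (\<Oplus>\<^bsub>W\<^esub>s\<in>?T. \<psi> s \<odot>\<^bsub>W\<^esub> y s)"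
      by (rule W.finsum_addf) (use c yT in blast)+
    also have "(\<Oplus>\<^bsub>W\<^esub>s\<in>?T. \<phi> s \<odot>\<^bsub>W\<^esub> y s) = free_ext W k y \<phi>"
      by (rule sub[OF \<phi> T(1) _ T(2), symmetric]) blast
    also have "(\<Oplus>\<^bsub>W\<^esub>s\<in>?T. \<psi> s \<odot>\<^bsub>W\<^esub> y s) = free_ext W k y \<psi>"
      by (rule sub[OF \<psi> T(1) _ T(2), symmetric]) blast
    finally show "free_ext W k y (\<phi> \<oplus>\<^bsub>?F\<^esub> \<psi>) = free_ext W k y \<phi> \<oplus>\<^bsub>W\<^esub> free_ext W k y \<psi>" .
  next
    fix c \<phi> assume c: "c \<in> carrier k" and \<phi>: "\<phi> \<in> carrier ?F"
    let ?T = "{s. \<phi> s \<noteq> \<zero>\<^bsub>k\<^esub>}"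
    have T: "finite ?T" "?T \<subseteq> S" using \<phi> by (auto simp: free_module_carrier)
    have \<phi>c: "\<phi> s \<in> carrier k" for s using \<phi> by (simp add: free_module_carrier)
    have yT: "y s \<in> carrier W" if "s \<in> ?T" for s using that T(2) y by blast
    have "free_ext W k y (c \<odot>\<^bsub>?F\<^esub> \<phi>) = (\<Oplus>\<^bsub>W\<^esub>s\<in>?T. (c \<odot>\<^bsub>?F\<^esub> \<phi>) s \<odot>\<^bsub>W\<^esub> y s)"
      by (rule sub[OF F.smult_closed[OF c \<phi>] T(1) _ T(2)]) (use c in \<open>auto simp: free_module_simps\<close>)
    also have "\<dots> = (\<Oplus>\<^bsub>W\<^esub>s\<in>?T. c \<odot>\<^bsub>W\<^esub> (\<phi> s \<odot>\<^bsub>W\<^esub> y s))"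
    proof (rule W.add.finprod_cong'[OF refl])
      show "(c \<odot>\<^bsub>?F\<^esub> \<phi>) s \<odot>\<^bsub>W\<^esub> y s = c \<odot>\<^bsub>W\<^esub> (\<phi> s \<odot>\<^bsub>W\<^esub> y s)" if "s \<in> ?T" for s
        unfolding free_module_simps by (rule W.smult_assoc1[OF c \<phi>c yT[OF that]])
    qed (use c \<phi>c yT in blast)
    also have "\<dots> = c \<odot>\<^bsub>W\<^esub> free_ext W k y \<phi>"
      unfolding free_ext_def
      by (rule W.finsum_smult_ldistr[OF T(1) c, symmetric]) (use \<phi>c yT in blast)
    finally show "free_ext W k y (c \<odot>\<^bsub>?F\<^esub> \<phi>) = c \<odot>\<^bsub>W\<^esub> free_ext W k y \<phi>" .
  qed
  show "free_ext W k y (free_gen k s) = y s" if "s \<in> S" for s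
  proof -
    have one: "free_gen k s s = \<one>\<^bsub>k\<^esub>" by (simp add: free_gen_def)
    have supp: "{t. free_gen k s t \<noteq> \<zero>\<^bsub>k\<^esub>} \<subseteq> {s}" by (auto simp: free_gen_def)
    have "free_ext W k y (free_gen k s) = (\<Oplus>\<^bsub>W\<^esub>t\<in>{s}. free_gen k s t \<odot>\<^bsub>W\<^esub> y t)"
      by (rule sub[OF free_gen_closed[OF W.R.is_cring that] _ supp]) (use that in auto)
    also have "\<dots> = free_gen k s s \<odot>\<^bsub>W\<^esub> y s"
      using y[OF that] by (subst W.add.finprod_singleton_swap[symmetric]) (auto simp: one)
    also have "\<dots> = y s" using y[OF that] by (simp add: one)
    finally show ?thesis .
  qed
qed

lemma free_linear_eqI:
  assumes k: "cring k" and W: "Module.module k W"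
    and f: "linear_map k (free_module k S) W f" and g: "linear_map k (free_module k S) W g"
    and eq: "\<And>s. s \<in> S \<Longrightarrow> f (free_gen k s) = g (free_gen k s)"
    and \<phi>: "\<phi> \<in> carrier (free_module k S)"
  shows "f \<phi> = g \<phi>"
proof -
  interpret cring k by fact
  let ?F = "free_module k S"
  interpret F: Module.module k ?F by (rule module_free_module[OF k])
  have "finite T \<Longrightarrow> \<forall>\<phi>. {s. \<phi> s \<noteq> \<zero>\<^bsub>k\<^esub>} = T \<longrightarrow> \<phi> \<in> carrier ?F \<longrightarrow> f \<phi> = g \<phi>" for T
  proof (induction T rule: finite_induct)
    case empty
    have "\<phi> = \<zero>\<^bsub>?F\<^esub>" if "{s. \<phi> s \<noteq> \<zero>\<^bsub>k\<^esub>} = {}" for \<phi>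
      using that by (auto simp: free_module_simps)
    then show ?case
      using linear_map_zero[OF F.module_axioms W f] linear_map_zero[OF F.module_axioms W g] by metis
  next
    case (insert p T)
    show ?case
    proof (intro allI impI)
      fix \<phi> assume supp: "{s. \<phi> s \<noteq> \<zero>\<^bsub>k\<^esub>} = insert p T" and \<phi>: "\<phi> \<in> carrier ?F"
      define \<psi> where "\<psi> = \<phi>(p := \<zero>\<^bsub>k\<^esub>)"
      have ps: "{s. \<psi> s \<noteq> \<zero>\<^bsub>k\<^esub>} = T" using supp insert.hyps by (auto simp: \<psi>_def)
      have pc: "\<psi> \<in> carrier ?F" using \<phi> insert.hyps ps supp
        unfolding free_module_carrier by (auto simp: \<psi>_def)
      have pS: "p \<in> S" "\<phi> p \<in> carrier k" using \<phi> supp by (auto simp: free_module_carrier)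
      have gc: "free_gen k p \<in> carrier ?F" by (rule free_gen_closed[OF k pS(1)])
      have dec: "\<phi> = \<psi> \<oplus>\<^bsub>?F\<^esub> (\<phi> p \<odot>\<^bsub>?F\<^esub> free_gen k p)"
        using \<phi> unfolding free_module_carrier free_module_simps
        by (auto simp: \<psi>_def free_gen_def)
      have "h \<phi> = h \<psi> \<oplus>\<^bsub>W\<^esub> \<phi> p \<odot>\<^bsub>W\<^esub> h (free_gen k p)" if "linear_map k ?F W h" for h
        using arg_cong[OF dec, of h] linear_mapD[OF that] pc gc pS by simp
      then show "f \<phi> = g \<phi>"
        using f g eq[OF pS(1)] insert.IH ps pc by metis
    qed
  qed
  then show ?thesis using \<phi> by (auto simp: free_module_carrier)
qed

definition transport_module :: "('v \<Rightarrow> 'w) \<Rightarrow> ('w \<Rightarrow> 'v) \<Rightarrow> ('k, 'v) module \<Rightarrow> ('k, 'w) module" where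
  "transport_module E D V =
     \<lparr>carrier = E ` carrier V, mult = (\<lambda>_ _. E \<zero>\<^bsub>V\<^esub>), one = E \<zero>\<^bsub>V\<^esub>, zero = E \<zero>\<^bsub>V\<^esub>,
      add = (\<lambda>x y. E (D x \<oplus>\<^bsub>V\<^esub> D y)), smult = (\<lambda>c x. E (c \<odot>\<^bsub>V\<^esub> D x))\<rparr>"

lemma transport_module:
  assumes V: "Module.module k V" and D: "\<And>x. x \<in> carrier V \<Longrightarrow> D (E x) = x"
  shows "Module.module k (transport_module E D V)"
    and "linear_map k V (transport_module E D V) E"
    and "linear_map k (transport_module E D V) V D"
proof -
  interpret V: Module.module k V by fact
  show "linear_map k V (transport_module E D V) E" "linear_map k (transport_module E D V) V D"
    by (auto simp: linear_map_def transport_module_def D)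
  show "Module.module k (transport_module E D V)"
  proof (rule moduleI[OF V.R.is_cring])
    show "abelian_group (transport_module E D V)"
    proof (rule abelian_groupI)
      fix x assume "x \<in> carrier (transport_module E D V)"
      then obtain v where v: "x = E v" "v \<in> carrier V" by (auto simp: transport_module_def)
      show "\<exists>y\<in>carrier (transport_module E D V). y \<oplus>\<^bsub>transport_module E D V\<^esub> x = \<zero>\<^bsub>transport_module E D V\<^esub>"
        by (rule bexI[of _ "E (\<ominus>\<^bsub>V\<^esub> v)"]) (use v in \<open>auto simp: transport_module_def D V.l_neg\<close>)
    qed (auto simp: transport_module_def D V.a_ac)
  qed (auto simp: transport_module_def D V.smult_l_distr V.smult_r_distr V.smult_assoc1)
qed

lemma persistence_moduleD:
  assumes "persistence_module k M"
  shows "Module.module k (stalk M a)"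
    and "a \<le> b \<Longrightarrow> linear_map k (stalk M a) (stalk M b) (res M a b)"
    and "x \<in> carrier (stalk M a) \<Longrightarrow> res M a a x = x"
    and "a \<le> b \<Longrightarrow> b \<le> c \<Longrightarrow> x \<in> carrier (stalk M a) \<Longrightarrow> res M b c (res M a b x) = res M a c x"
  using assms by (auto simp: persistence_module_def)

lemma pmorphismD:
  assumes "pmorphism k M N f"
  shows "linear_map k (stalk M a) (stalk N a) (f a)"
    and "a \<le> b \<Longrightarrow> x \<in> carrier (stalk M a) \<Longrightarrow> f b (res M a b x) = res N a b (f a x)"
  using assms by (auto simp: pmorphism_def)

text \<open>If the universe \<open>'u\<close> contains codes for the lists over \<open>'i \<times> 'u \<times> 'k\<close>, then every
  persistence module is a quotient of the projective module \<open>\<Oplus>\<^bsub>(a,x)\<^esub> k[U\<^sub>a]\<close>, where \<open>x \<in> M\<^sub>a\<close>.\<close>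

lemma enough_projectives:
  fixes k :: "'k ring" and M :: "('i::order, 'k, 'u) pmod" and code :: "('i \<times> 'u \<times> 'k) list \<Rightarrow> 'u"
  assumes k: "cring k" and code: "inj code" and M: "persistence_module k M"
  shows "\<exists>(P :: ('i, 'k, 'u) pmod) e. projective k P \<and> pmorphism k P M e \<and> pepi P M e"
proof -
  define E :: "('i \<times> 'u \<Rightarrow> 'k) \<Rightarrow> 'u" where
    "E \<phi> = code (SOME l. set l = {(a, x, \<phi> (a, x)) | a x. \<phi> (a, x) \<noteq> \<zero>\<^bsub>k\<^esub>})" for \<phi>
  define fs where "fs = {\<phi> :: 'i \<times> 'u \<Rightarrow> 'k. finite {s. \<phi> s \<noteq> \<zero>\<^bsub>k\<^esub>}}"
  have injE: "inj_on E fs"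
  proof (rule inj_onI)
    fix \<phi> \<psi> assume \<phi>: "\<phi> \<in> fs" and \<psi>: "\<psi> \<in> fs" and eq: "E \<phi> = E \<psi>"
    let ?G = "\<lambda>\<phi>. {(a, x, \<phi> (a, x)) | a x. \<phi> (a, x) \<noteq> \<zero>\<^bsub>k\<^esub>}"
    have "finite (?G \<theta>)" if "\<theta> \<in> fs" for \<theta>
    proof -
      have "?G \<theta> = (\<lambda>s. (fst s, snd s, \<theta> s)) ` {s. \<theta> s \<noteq> \<zero>\<^bsub>k\<^esub>}" by force
      then show ?thesis using that by (simp add: fs_def)
    qed
    then have G: "set (SOME l. set l = ?G \<theta>) = ?G \<theta>" if "\<theta> \<in> fs" for \<theta>
      by (rule someI_ex[OF finite_list]) (use that in blast)
    have "(SOME l. set l = ?G \<phi>) = (SOME l. set l = ?G \<psi>)"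
      by (rule injD[OF code]) (use eq in \<open>simp only: E_def\<close>)
    from arg_cong[OF this, of set] have G: "?G \<phi> = ?G \<psi>"
      unfolding G[OF \<phi>] G[OF \<psi>] .
    have "\<phi> s = \<psi> s" for s
    proof -
      obtain a x where s: "s = (a, x)" by fastforce
      have "(a, x, z) \<in> ?G \<phi> \<longleftrightarrow> (a, x, z) \<in> ?G \<psi>" for z using G by blast
      from this[of "\<phi> s"] this[of "\<psi> s"] show ?thesis unfolding s by auto
    qed
    then show "\<phi> = \<psi>" by blast
  qed
  define D where "D = inv_into fs E"
  define S where "S b = {(a, x). a \<le> b \<and> x \<in> carrier (stalk M a)}" for b
  define F where "F b = free_module k (S b)" for b
  have DE: "D (E \<phi>) = \<phi>" if "\<phi> \<in> carrier (F b)" for \<phi> b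
    unfolding D_def using that by (intro inv_into_f_f injE) (simp add: fs_def F_def free_module_carrier)
  define Q :: "('i, 'k, 'u) pmod" where
    "Q = \<lparr>stalk = (\<lambda>b. transport_module E D (F b)), res = (\<lambda>_ _ x. x)\<rparr>"
  have F: "Module.module k (F b)" for b unfolding F_def by (rule module_free_module[OF k])
  note tr = transport_module[OF F DE]
  have Fmono: "carrier (F b) \<subseteq> carrier (F c)" if "b \<le> c" for b c
  proof -
    have "S b \<subseteq> S c" using that by (auto simp: S_def)
    then show ?thesis unfolding F_def by (force simp: free_module_carrier)
  qed
  have Q: "persistence_module k Q"
    unfolding persistence_module_def
  proof (intro conjI allI impI ballI)
    show "Module.module k (stalk Q a)" for a unfolding Q_def by (simp add: tr)
    show "linear_map k (stalk Q a) (stalk Q b) (res Q a b)" if "a \<le> b" for a b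
      using Fmono[OF that]
      by (auto simp: Q_def linear_map_def transport_module_def F_def free_module_simps)
  qed (simp_all add: Q_def)
  have Qcar: "carrier (stalk Q b) = E ` carrier (F b)" for b
    by (simp add: Q_def transport_module_def)
  define ext where "ext A y b z = free_ext (stalk A b) k (\<lambda>(a, x). res A a b (y a x)) (D z)"
    for A :: "('i, 'k, 'u) pmod" and y b z
  have gen: "free_gen k (a, x) \<in> carrier (F b)" if "a \<le> b" "x \<in> carrier (stalk M a)" for a b x
    unfolding F_def using that by (intro free_gen_closed[OF k]) (auto simp: S_def)
  have eqI: "f z = g z"
    if W: "Module.module k W" and fg: "linear_map k (stalk Q b) W f" "linear_map k (stalk Q b) W g"
      and z: "z \<in> carrier (stalk Q b)"
      and eq: "\<And>a x. a \<le> b \<Longrightarrow> x \<in> carrier (stalk M a) \<Longrightarrow> f (E (free_gen k (a, x))) = g (E (free_gen k (a, x)))"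
    for W :: "('k, 'u) module" and b f g z
  proof -
    obtain \<phi> where \<phi>: "z = E \<phi>" "\<phi> \<in> carrier (F b)" using z Qcar by auto
    have EL: "linear_map k (F b) (stalk Q b) E" by (simp add: Q_def tr)
    have "f (E (free_gen k s)) = g (E (free_gen k s))" if "s \<in> S b" for s
      using that eq by (cases s) (simp add: S_def)
    from free_linear_eqI[OF k W linear_map_comp[OF EL fg(1), unfolded F_def]
        linear_map_comp[OF EL fg(2), unfolded F_def] this \<phi>(2)[unfolded F_def]]
    show ?thesis unfolding \<phi>(1) .
  qed
  have ext: "pmorphism k Q A (ext A y)"
      "\<And>a b x. a \<le> b \<Longrightarrow> x \<in> carrier (stalk M a) \<Longrightarrow>
          ext A y b (E (free_gen k (a, x))) = res A a b (y a x)"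
    if A: "persistence_module k A"
      and y: "\<And>a x. x \<in> carrier (stalk M a) \<Longrightarrow> y a x \<in> carrier (stalk A a)" for A y
  proof -
    note AD = persistence_moduleD[OF A]
    have yS: "(case s of (a, x) \<Rightarrow> res A a b (y a x)) \<in> carrier (stalk A b)" if "s \<in> S b" for s b
      using that y linear_mapD(1)[OF AD(2)] by (auto simp: S_def)
    have fe: "linear_map k (F b) (stalk A b) (free_ext (stalk A b) k (\<lambda>(a, x). res A a b (y a x)))"
      "s \<in> S b \<Longrightarrow> free_ext (stalk A b) k (\<lambda>(a, x). res A a b (y a x)) (free_gen k s) =
        (case s of (a, x) \<Rightarrow> res A a b (y a x))" for b s
      unfolding F_def by (rule free_ext[OF AD(1) yS]; assumption)+
    have lin: "linear_map k (stalk Q b) (stalk A b) (ext A y b)" for b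
      unfolding ext_def
      by (rule linear_map_comp[OF _ fe(1)]) (simp add: Q_def tr)
    show val: "ext A y b (E (free_gen k (a, x))) = res A a b (y a x)"
      if "a \<le> b" "x \<in> carrier (stalk M a)" for a b x
    proof -
      have "(a, x) \<in> S b" using that by (simp add: S_def)
      from fe(2)[OF this] show ?thesis using DE[OF gen[OF that]] by (simp add: ext_def)
    qed
    show "pmorphism k Q A (ext A y)"
      unfolding pmorphism_def
    proof (intro conjI allI impI ballI lin)
      fix b c z assume bc: "b \<le> c" and z: "z \<in> carrier (stalk Q b)"
      show "ext A y c (res Q b c z) = res A b c (ext A y b z)"
      proof (rule eqI[OF AD(1) _ _ z])
        show "linear_map k (stalk Q b) (stalk A c) (\<lambda>z. ext A y c (res Q b c z))"
          by (rule linear_map_comp[OF persistence_moduleD(2)[OF Q bc] lin])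
        show "linear_map k (stalk Q b) (stalk A c) (\<lambda>z. res A b c (ext A y b z))"
          by (rule linear_map_comp[OF lin AD(2)[OF bc]])
        fix a x assume ax: "a \<le> b" "x \<in> carrier (stalk M a)"
        show "ext A y c (res Q b c (E (free_gen k (a, x)))) =
            res A b c (ext A y b (E (free_gen k (a, x))))"
          using val[OF ax] val[of a c x] ax bc AD(4)[OF ax(1) bc y[OF ax(2)]]
          by (simp add: Q_def)
      qed
    qed
  qed
  have Qgen: "E (free_gen k (a, x)) \<in> carrier (stalk Q b)"
    if "a \<le> b" "x \<in> carrier (stalk M a)" for a b x
    using gen[OF that] Qcar by auto
  have "projective k Q"
    unfolding projective_def
  proof (intro conjI allI impI Q)
    fix A B :: "('i, 'k, 'u) pmod" and g f
    assume A: "persistence_module k A" and B: "persistence_module k B"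
      and g: "pmorphism k A B g" "pepi A B g" and f: "pmorphism k Q B f"
    define y where "y a x = (SOME y. y \<in> carrier (stalk A a) \<and> g a y = f a (E (free_gen k (a, x))))"
      for a x
    have y: "y a x \<in> carrier (stalk A a) \<and> g a (y a x) = f a (E (free_gen k (a, x)))"
      if "x \<in> carrier (stalk M a)" for a x
    proof -
      have "f a (E (free_gen k (a, x))) \<in> g a ` carrier (stalk A a)"
        using linear_mapD(1)[OF pmorphismD(1)[OF f] Qgen[OF order_refl that]] g(2)
        by (simp add: pepi_def)
      then have "\<exists>y. y \<in> carrier (stalk A a) \<and> g a y = f a (E (free_gen k (a, x)))" by auto
      then show ?thesis unfolding y_def by (rule someI_ex)
    qed
    note h = ext[OF A, of y]
    have "pmorphism_eq Q (pcomp g (ext A y)) f"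
      unfolding pmorphism_eq_def pcomp_def
    proof (intro allI ballI)
      fix b z assume z: "z \<in> carrier (stalk Q b)"
      show "g b (ext A y b z) = f b z"
      proof (rule eqI[OF persistence_moduleD(1)[OF B] _ pmorphismD(1)[OF f] z])
        show "linear_map k (stalk Q b) (stalk B b) (\<lambda>z. g b (ext A y b z))"
          by (rule linear_map_comp[OF pmorphismD(1)[OF h(1)] pmorphismD(1)[OF g(1)]]) (use y in blast)
        fix a x assume ax: "a \<le> b" "x \<in> carrier (stalk M a)"
        have "g b (ext A y b (E (free_gen k (a, x)))) = g b (res A a b (y a x))"
          using h(2) y ax by metis
        also have "\<dots> = res B a b (f a (E (free_gen k (a, x))))"
          using pmorphismD(2)[OF g(1) ax(1)] y[OF ax(2)] by metis
        also have "\<dots> = f b (E (free_gen k (a, x)))"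
          using pmorphismD(2)[OF f ax(1) Qgen[OF order_refl ax(2)]] by (simp add: Q_def)
        finally show "g b (ext A y b (E (free_gen k (a, x)))) = f b (E (free_gen k (a, x)))" .
      qed
    qed
    then show "\<exists>h. pmorphism k Q A h \<and> pmorphism_eq Q (pcomp g h) f"
      using h(1) y by blast
  qed
  moreover have "pmorphism k Q M (ext M (\<lambda>a x. x))" by (rule ext(1)[OF M])
  moreover have "pepi Q M (ext M (\<lambda>a x. x))"
    unfolding pepi_def
  proof (intro allI equalityI subsetI)
    fix a x assume "x \<in> ext M (\<lambda>a x. x) a ` carrier (stalk Q a)"
    then show "x \<in> carrier (stalk M a)"
      using linear_mapD(1)[OF pmorphismD(1)[OF ext(1)[OF M]]] by auto
  next
    fix a x assume x: "x \<in> carrier (stalk M a)"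
    then have "ext M (\<lambda>a x. x) a (E (free_gen k (a, x))) = x"
      using ext(2)[OF M, of "\<lambda>a x. x"] persistence_moduleD(3)[OF M x] by simp
    then show "x \<in> ext M (\<lambda>a x. x) a ` carrier (stalk Q a)"
      using Qgen[OF order_refl x] by (metis image_eqI)
  qed
  ultimately show ?thesis by blast
qed

definition pkernel ::
  "('i, 'k, 'u) pmod \<Rightarrow> ('i, 'k, 'u) pmod \<Rightarrow> ('i \<Rightarrow> 'u \<Rightarrow> 'u) \<Rightarrow> ('i, 'k, 'u) pmod" where
  "pkernel M N f = M\<lparr>stalk := \<lambda>a. (stalk M a)\<lparr>carrier :=
     {x \<in> carrier (stalk M a). f a x = \<zero>\<^bsub>stalk N a\<^esub>}\<rparr>\<rparr>"

lemma persistence_module_pkernel: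
  assumes M: "persistence_module k M" and N: "persistence_module k N" and f: "pmorphism k M N f"
  shows "persistence_module k (pkernel M N f)"
proof -
  note MD = persistence_moduleD[OF M] and ND = persistence_moduleD[OF N]
  have f0: "f a \<zero>\<^bsub>stalk M a\<^esub> = \<zero>\<^bsub>stalk N a\<^esub>" for a
    by (rule linear_map_zero[OF MD(1) ND(1) pmorphismD(1)[OF f]])
  have r0: "res N a b \<zero>\<^bsub>stalk N a\<^esub> = \<zero>\<^bsub>stalk N b\<^esub>" if "a \<le> b" for a b
    by (rule linear_map_zero[OF ND(1) ND(1) ND(2)[OF that]])
  have "Module.module k (stalk (pkernel M N f) a)" for a
  proof -
    interpret V: Module.module k "stalk M a" by (rule MD)
    interpret W: Module.module k "stalk N a" by (rule ND)
    note L = linear_mapD[OF pmorphismD(1)[OF f, of a]]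
    let ?H = "{x \<in> carrier (stalk M a). f a x = \<zero>\<^bsub>stalk N a\<^esub>}"
    have sm: "c \<odot>\<^bsub>stalk M a\<^esub> x \<in> ?H" if "c \<in> carrier k" "x \<in> ?H" for c x
      using that L(3) by auto
    have "submodule ?H k (stalk M a)"
    proof (rule V.submoduleI)
      fix x assume x: "x \<in> ?H"
      have "\<ominus>\<^bsub>stalk M a\<^esub> x = (\<ominus>\<^bsub>k\<^esub> \<one>\<^bsub>k\<^esub>) \<odot>\<^bsub>stalk M a\<^esub> x"
        using x V.smult_l_minus[of "\<one>\<^bsub>k\<^esub>" x] by simp
      then show "\<ominus>\<^bsub>stalk M a\<^esub> x \<in> ?H" using sm x by simp
    qed (use sm f0 L(2) in auto)
    from submodule.submodule_is_module[OF this MD(1)] show ?thesis by (simp add: pkernel_def)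
  qed
  moreover have "linear_map k (stalk (pkernel M N f) a) (stalk (pkernel M N f) b)
      (res (pkernel M N f) a b)" if "a \<le> b" for a b
    using MD(2)[OF that] pmorphismD(2)[OF f that] r0[OF that]
    by (auto simp: pkernel_def linear_map_def)
  ultimately show ?thesis
    using M unfolding persistence_module_def pkernel_def by simp
qed

lemma projective_resolution_exists:
  fixes k :: "'k ring" and M :: "('i::order, 'k, 'u) pmod" and code :: "('i \<times> 'u \<times> 'k) list \<Rightarrow> 'u"
  assumes k: "cring k" and code: "inj code" and M: "persistence_module k M"
  shows "\<exists>P d e. projective_resolution k P d e M"
proof -
  let ?c = "\<lambda>(M :: ('i, 'k, 'u) pmod) z. projective k (fst z :: ('i, 'k, 'u) pmod) \<and> pmorphism k (fst z) M (snd z) \<and>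
    pepi (fst z) M (snd z)"
  define cov where "cov M = (SOME z. ?c M z)" for M :: "('i, 'k, 'u) pmod"
  define K where "K = rec_nat M (\<lambda>_ M. pkernel (fst (cov M)) M (snd (cov M)))"
  have K0: "K 0 = M" and KS: "K (Suc i) = pkernel (fst (cov (K i))) (K i) (snd (cov (K i)))" for i
    by (simp_all add: K_def)
  have covI: "?c M (cov M)" if "persistence_module k M" for M
    using enough_projectives[OF k code that] unfolding cov_def
    by (intro someI_ex[of "?c M"]) auto
  have K: "persistence_module k (K i)" for i
  proof (induction i)
    case (Suc i)
    from covI[OF Suc] show ?case unfolding KS
      by (intro persistence_module_pkernel Suc) (auto simp: projective_def)
  qed (simp add: K0 M)
  note C = covI[OF K]
  have "projective_resolution k (\<lambda>i. fst (cov (K i))) (\<lambda>i. snd (cov (K (Suc i)))) (snd (cov (K 0))) M"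
    unfolding projective_resolution_def
  proof (intro conjI allI)
    show "pmorphism k (fst (cov (K (Suc i)))) (fst (cov (K i))) (snd (cov (K (Suc i))))" for i
    proof -
      have "pmorphism k (fst (cov (K (Suc i)))) (pkernel (fst (cov (K i))) (K i) (snd (cov (K i))))
          (snd (cov (K (Suc i))))" using C[of "Suc i"] by (simp add: KS)
      then show ?thesis by (auto simp: pmorphism_def linear_map_def pkernel_def)
    qed
    have ex: "exact_at (fst (cov (K (Suc i)))) (snd (cov (K (Suc i)))) (fst (cov (K i)))
        (snd (cov (K i))) (K i)" for i
      using C[of "Suc i"] unfolding exact_at_def pepi_def
      by (subst (asm) (3) KS) (simp add: pkernel_def)
    from ex[of 0] show "exact_at (fst (cov (K (Suc 0)))) (snd (cov (K (Suc 0)))) (fst (cov (K 0)))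
        (snd (cov (K 0))) M" by (simp add: K0)
    show "exact_at (fst (cov (K (Suc (Suc i))))) (snd (cov (K (Suc (Suc i)))))
        (fst (cov (K (Suc i)))) (snd (cov (K (Suc i)))) (fst (cov (K i)))" for i
    proof -
      have "\<zero>\<^bsub>stalk (K (Suc i)) a\<^esub> = \<zero>\<^bsub>stalk (fst (cov (K i))) a\<^esub>" for a
        by (simp add: KS pkernel_def)
      then show ?thesis using ex[of "Suc i"] by (simp add: exact_at_def)
    qed
  qed (use C[of 0] C in \<open>auto simp: K0\<close>)
  then show ?thesis by blast
qed

text \<open>Every type \<open>'u\<close> embeds into such a universe, by \<open>Atom\<close>.\<close>

datatype ('i, 'k, 'u) universe = Atom 'u | Code "('i \<times> ('i, 'k, 'u) universe \<times> 'k) list"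

corollary left_derived_nonempty:
  fixes k :: "'k ring" and M :: "('i::order, 'k, ('i, 'k, 'u) universe) pmod"
  assumes "cring k" "persistence_module k M"
  shows "left_derived k Fo Fm i M \<noteq> {}"
  using projective_resolution_exists[OF assms(1) _ assms(2), of Code]
  by (auto simp: left_derived_def inj_def)

end

theory Submission
  imports Defs
begin

text \<open>Over a field every linear map \<open>g\<close> has a linear generalized inverse \<open>q\<close>, \<open>g q g = g\<close>, by Zorn's
  lemma. If \<open>f\<close> and \<open>g\<close> are composable linear maps with \<open>im f = ker g\<close>, this gives linear maps \<open>p\<close>
  and \<open>q\<close> with \<open>f p + q g = id\<close>. An additive functor of vector spaces preserves such identities, and
  hence exactness; likewise it preserves one-sided inverses, hence injectivity and surjectivity. The
  splittings need not commute with the restriction maps of persistence modules, but exactness and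
  homology are computed at each stalk, and so is the sheaf tensor product.\<close>

subsection \<open>Splittings of linear maps over a field\<close>

text \<open>Exactness is proved at the middle of an arbitrary composable pair, not only for short
  exact sequences: the differentials of a resolution are in general neither injective nor
  surjective, so the vanishing of Tor follows without cutting the resolution into short exact
  pieces. Scalars are inverted at a single point, in the construction of complements; everything on
  tensor products works over the underlying commutative ring. There the obstacle is that
  \<open>tensor_module\<close> consists of cosets and \<open>tensor_map\<close> is a union over
  representatives. Well-definedness comes from the fact that a linear map on the free module that is
  bilinear on generators kills the relations. After that no representative is touched again: two
  linear maps on a tensor product are compared on pure tensors. Since maps are total functions that
  matter only on carriers, a congruence rule has to accompany each functoriality law.\<close>

lemma (in abelian_group) minus_eq_zero_iff:
  assumes "x \<in> carrier G" "y \<in> carrier G"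
  shows "x \<ominus> y = \<zero> \<longleftrightarrow> x = y"
proof
  assume "x \<ominus> y = \<zero>"
  then have "x \<ominus> y \<oplus> y = y" using assms by simp
  then show "x = y" using assms by (simp add: minus_eq a_assoc l_neg)
qed (use assms in \<open>simp add: minus_eq r_neg\<close>)

text \<open>Closure under negation comes for free because -x = (-1) x, and zero is the 0-multiple of
  any element, so the group axioms in \<open>submodule\<close> reduce to these closure
  conditions.\<close>

lemma submodule_iff:
  assumes "Module.module k V"
  shows "submodule H k V \<longleftrightarrow> H \<subseteq> carrier V \<and> \<zero>\<^bsub>V\<^esub> \<in> H \<and>
     (\<forall>x\<in>H. \<forall>y\<in>H. x \<oplus>\<^bsub>V\<^esub> y \<in> H) \<and> (\<forall>c\<in>carrier k. \<forall>x\<in>H. c \<odot>\<^bsub>V\<^esub> x \<in> H)" (is "_ \<longleftrightarrow> ?R")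
proof
  interpret Module.module k V by fact
  show ?R if H: "submodule H k V"
  proof -
    note E = submoduleE[OF H]
    from E(2) obtain x where x: "x \<in> H" by blast
    have "\<zero>\<^bsub>k\<^esub> \<odot>\<^bsub>V\<^esub> x \<in> H" using E(4) x by blast
    then have "\<zero>\<^bsub>V\<^esub> \<in> H" using x E(1) by auto
    then show ?thesis using E by blast
  qed
  show "submodule H k V" if R: ?R
  proof (rule submoduleI)
    fix x assume x: "x \<in> H"
    have "\<ominus>\<^bsub>V\<^esub> x = (\<ominus>\<^bsub>k\<^esub> \<one>\<^bsub>k\<^esub>) \<odot>\<^bsub>V\<^esub> x"
      using x R smult_l_minus[of "\<one>\<^bsub>k\<^esub>" x] by auto
    then show "\<ominus>\<^bsub>V\<^esub> x \<in> H" using R x by simp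
  qed (use R in auto)
qed

lemma submoduleD:
  assumes "Module.module k V" "submodule H k V"
  shows "H \<subseteq> carrier V" "x \<in> H \<Longrightarrow> x \<in> carrier V" "\<zero>\<^bsub>V\<^esub> \<in> H"
    "x \<in> H \<Longrightarrow> y \<in> H \<Longrightarrow> x \<oplus>\<^bsub>V\<^esub> y \<in> H" "x \<in> H \<Longrightarrow> y \<in> H \<Longrightarrow> x \<ominus>\<^bsub>V\<^esub> y \<in> H"
    "c \<in> carrier k \<Longrightarrow> x \<in> H \<Longrightarrow> c \<odot>\<^bsub>V\<^esub> x \<in> H"
proof -
  show "x \<ominus>\<^bsub>V\<^esub> y \<in> H" if "x \<in> H" "y \<in> H"
    using module.submoduleE(3,5)[OF assms] that by (simp add: a_minus_def)
qed (use submodule_iff[OF assms(1), of H] assms(2) in auto)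

lemma linear_map_minus:
  assumes V: "Module.module k V" and W: "Module.module k W" and f: "linear_map k V W f"
    and x: "x \<in> carrier V" and y: "y \<in> carrier V"
  shows "f (x \<ominus>\<^bsub>V\<^esub> y) = f x \<ominus>\<^bsub>W\<^esub> f y"
proof -
  interpret V: Module.module k V by fact
  interpret W: Module.module k W by fact
  note L = linear_mapD[OF f]
  have "f (x \<ominus>\<^bsub>V\<^esub> y) \<oplus>\<^bsub>W\<^esub> f y = f (x \<ominus>\<^bsub>V\<^esub> y \<oplus>\<^bsub>V\<^esub> y)"
    by (rule L(2)[symmetric]) (use x y in auto)
  also have "x \<ominus>\<^bsub>V\<^esub> y \<oplus>\<^bsub>V\<^esub> y = x"
    using x y by (simp add: V.minus_eq V.a_assoc V.l_neg)
  finally show ?thesis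
    using L(1) x y by (metis V.minus_closed W.add.inv_solve_right a_minus_def)
qed

lemma linear_map_id: "linear_map k V V (\<lambda>x. x)"
  by (simp add: linear_map_def)

lemma linear_map_add:
  assumes W: "Module.module k W" and f: "linear_map k V W f" and g: "linear_map k V W g"
  shows "linear_map k V W (\<lambda>x. f x \<oplus>\<^bsub>W\<^esub> g x)"
proof -
  interpret Module.module k W by fact
  show ?thesis
    by (auto simp: linear_map_def linear_mapD[OF f] linear_mapD[OF g] smult_r_distr a_ac)
qed

lemma linear_map_diff:
  assumes W: "Module.module k W" and f: "linear_map k V W f" and g: "linear_map k V W g"
  shows "linear_map k V W (\<lambda>x. f x \<ominus>\<^bsub>W\<^esub> g x)"
proof -
  interpret Module.module k W by fact
  show ?thesis
    by (auto simp: linear_map_def linear_mapD[OF f] linear_mapD[OF g] smult_r_distr a_ac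
        a_minus_def smult_r_minus minus_add)
qed

lemma submodule_image:
  assumes V: "Module.module k V" and W: "Module.module k W" and f: "linear_map k V W f"
  shows "submodule (f ` carrier V) k W"
proof -
  interpret V: Module.module k V by fact
  note L = linear_mapD[OF f]
  show ?thesis
    unfolding submodule_iff[OF W]
  proof (intro conjI ballI)
    show "\<zero>\<^bsub>W\<^esub> \<in> f ` carrier V"
      using linear_map_zero[OF V W f] V.zero_closed by (metis image_eqI)
    show "x \<oplus>\<^bsub>W\<^esub> y \<in> f ` carrier V" if "x \<in> f ` carrier V" "y \<in> f ` carrier V" for x y
      using that L(2)[symmetric] by auto
    show "c \<odot>\<^bsub>W\<^esub> x \<in> f ` carrier V" if "c \<in> carrier k" "x \<in> f ` carrier V" for c x
      using that L(3)[symmetric] by auto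
  qed (use L in auto)
qed

lemma submodule_vimage:
  assumes V: "Module.module k V" and W: "Module.module k W" and f: "linear_map k V W f"
    and H: "submodule H k W"
  shows "submodule {x \<in> carrier V. f x \<in> H} k V"
proof -
  interpret V: Module.module k V by fact
  show ?thesis
    unfolding submodule_iff[OF V]
    using linear_mapD[OF f] linear_map_zero[OF V W f] submoduleD[OF W H] by auto
qed

lemma submodule_zero:
  assumes V: "Module.module k V"
  shows "submodule {\<zero>\<^bsub>V\<^esub>} k V"
proof -
  interpret V: Module.module k V by fact
  show ?thesis unfolding submodule_iff[OF V] by auto
qed

section \<open>Complements, projections and generalized inverses\<close>

text \<open>Take \<open>H\<close> maximal among the submodules meeting \<open>K\<close> only in
  zero. If some \<open>x\<close> were outside \<open>H + K\<close>, adjoining it to \<open>H\<close>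
  would keep the intersection with \<open>K\<close> trivial, against maximality.\<close>

lemma submodule_complement_exists:
  assumes k: "field k" and V: "Module.module k V" and K: "submodule K k V"
  obtains H where "submodule H k V" "H \<inter> K = {\<zero>\<^bsub>V\<^esub>}"
    "\<And>x. x \<in> carrier V \<Longrightarrow> \<exists>h\<in>H. \<exists>y\<in>K. x = h \<oplus>\<^bsub>V\<^esub> y"
proof -
  interpret k: field k by fact
  interpret V: Module.module k V by fact
  note KD = submoduleD[OF V K]
  define \<A> where "\<A> = {H. submodule H k V \<and> H \<inter> K = {\<zero>\<^bsub>V\<^esub>}}"
  have "{\<zero>\<^bsub>V\<^esub>} \<in> \<A>" using KD submodule_zero[OF V] by (auto simp: \<A>_def)
  moreover have "\<Union>\<C> \<in> \<A>" if ne: "\<C> \<noteq> {}" and ch: "subset.chain \<A> \<C>" for \<C>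
  proof -
    have C: "submodule H k V" "H \<inter> K = {\<zero>\<^bsub>V\<^esub>}" if "H \<in> \<C>" for H
      using ch that by (auto simp: subset_chain_def \<A>_def)
    have "submodule (\<Union>\<C>) k V"
      unfolding submodule_iff[OF V]
    proof (intro conjI ballI)
      fix x y assume "x \<in> \<Union>\<C>" "y \<in> \<Union>\<C>"
      then obtain X Y where XY: "X \<in> \<C>" "x \<in> X" "Y \<in> \<C>" "y \<in> Y" by blast
      have "X \<subseteq> Y \<or> Y \<subseteq> X" using ch XY by (auto simp: subset_chain_def)
      then show "x \<oplus>\<^bsub>V\<^esub> y \<in> \<Union>\<C>"
        using XY submoduleD(4)[OF V C(1)] by blast
    next
      show "\<Union>\<C> \<subseteq> carrier V" using submoduleD(1)[OF V C(1)] by blast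
      show "\<zero>\<^bsub>V\<^esub> \<in> \<Union>\<C>" using ne submoduleD(3)[OF V C(1)] by blast
      fix c x assume "c \<in> carrier k" "x \<in> \<Union>\<C>"
      then show "c \<odot>\<^bsub>V\<^esub> x \<in> \<Union>\<C>" using submoduleD(6)[OF V C(1)] by blast
    qed
    then show ?thesis using C(2) ne by (auto simp: \<A>_def)
  qed
  ultimately obtain H where "H \<in> \<A>" and max: "\<And>X. X \<in> \<A> \<Longrightarrow> H \<subseteq> X \<Longrightarrow> X = H"
    using subset_Zorn_nonempty[of \<A>] by blast
  then have H: "submodule H k V" and HK: "H \<inter> K = {\<zero>\<^bsub>V\<^esub>}" by (auto simp: \<A>_def)
  note HD = submoduleD[OF V H]
  have "\<exists>h\<in>H. \<exists>y\<in>K. x = h \<oplus>\<^bsub>V\<^esub> y" if x: "x \<in> carrier V" for x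
  proof (rule ccontr)
    assume nd: "\<not> ?thesis"
    \<comment> \<open>This is \<open>H + k x\<close>, the submodule obtained by adjoining the
      missing vector.\<close>
    define X where "X = {h \<oplus>\<^bsub>V\<^esub> c \<odot>\<^bsub>V\<^esub> x | h c. h \<in> H \<and> c \<in> carrier k}"
    have XI: "h \<oplus>\<^bsub>V\<^esub> c \<odot>\<^bsub>V\<^esub> x \<in> X" if "h \<in> H" "c \<in> carrier k" for h c
      using that by (auto simp: X_def)
    have HX: "H \<subseteq> X"
    proof
      fix h assume h: "h \<in> H"
      then show "h \<in> X" using XI[of h "\<zero>\<^bsub>k\<^esub>"] HD(2) x by simp
    qed
    have "submodule X k V"
      unfolding submodule_iff[OF V]
    proof (intro conjI ballI)
      show "X \<subseteq> carrier V" using HD(2) x by (auto simp: X_def)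
      show "\<zero>\<^bsub>V\<^esub> \<in> X" using HX HD(3) by blast
      fix u assume "u \<in> X"
      then obtain h c where u: "u = h \<oplus>\<^bsub>V\<^esub> c \<odot>\<^bsub>V\<^esub> x" "h \<in> H" "c \<in> carrier k" by (auto simp: X_def)
      show "a \<odot>\<^bsub>V\<^esub> u \<in> X" if a: "a \<in> carrier k" for a
        using XI[OF HD(6)[OF a u(2)], of "a \<otimes>\<^bsub>k\<^esub> c"] u a x HD(2)
        by (simp add: V.smult_r_distr V.smult_assoc1)
      fix v assume "v \<in> X"
      then obtain h' c' where v: "v = h' \<oplus>\<^bsub>V\<^esub> c' \<odot>\<^bsub>V\<^esub> x" "h' \<in> H" "c' \<in> carrier k" by (auto simp: X_def)
      show "u \<oplus>\<^bsub>V\<^esub> v \<in> X"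
        using XI[OF HD(4)[OF u(2) v(2)], of "c \<oplus>\<^bsub>k\<^esub> c'"] u v x HD(2)
        by (simp add: V.smult_l_distr V.a_ac)
    qed
    moreover have "X \<inter> K = {\<zero>\<^bsub>V\<^esub>}"
    proof -
      have "u = \<zero>\<^bsub>V\<^esub>" if "u \<in> X" and uK: "u \<in> K" for u
      proof -
        from that obtain h c where u: "u = h \<oplus>\<^bsub>V\<^esub> c \<odot>\<^bsub>V\<^esub> x" and h: "h \<in> H" and c: "c \<in> carrier k"
          by (auto simp: X_def)
        have hV: "h \<in> carrier V" and uV: "u \<in> carrier V" using h uK HD KD by auto
        show ?thesis
        proof (cases "c = \<zero>\<^bsub>k\<^esub>")
          case True
          then have "u = h" using u x hV by simp
          then show ?thesis using h uK HK by blast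
        next
          case False
          \<comment> \<open>The field hypothesis enters here: with \<open>c\<close> nonzero, the
            equation h + c x = u can be solved for \<open>x\<close>, which places \<open>x\<close>
            in \<open>H + K\<close> and contradicts \<open>nd\<close>.\<close>
          let ?i = "inv\<^bsub>k\<^esub> c"
          have i: "?i \<in> carrier k" "?i \<otimes>\<^bsub>k\<^esub> c = \<one>\<^bsub>k\<^esub>"
            using False c k.field_Units by auto
          have "c \<odot>\<^bsub>V\<^esub> x = (\<zero>\<^bsub>V\<^esub> \<ominus>\<^bsub>V\<^esub> h) \<oplus>\<^bsub>V\<^esub> u"
            unfolding u using hV c x by (simp add: a_minus_def V.r_neg1)
          then have "?i \<odot>\<^bsub>V\<^esub> (c \<odot>\<^bsub>V\<^esub> x) = ?i \<odot>\<^bsub>V\<^esub> (\<zero>\<^bsub>V\<^esub> \<ominus>\<^bsub>V\<^esub> h) \<oplus>\<^bsub>V\<^esub> ?i \<odot>\<^bsub>V\<^esub> u"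
            using i hV uV by (simp add: V.smult_r_distr)
          then have "x = ?i \<odot>\<^bsub>V\<^esub> (\<zero>\<^bsub>V\<^esub> \<ominus>\<^bsub>V\<^esub> h) \<oplus>\<^bsub>V\<^esub> ?i \<odot>\<^bsub>V\<^esub> u"
            using i c x by (simp add: V.smult_assoc1[symmetric])
          then show ?thesis
            using nd HD(6)[OF i(1) HD(5)[OF HD(3) h]] KD(6)[OF i(1) uK] by blast
        qed
      qed
      then show ?thesis using HX HD(3) KD(3) by blast
    qed
    ultimately have "X \<in> \<A>" by (simp add: \<A>_def)
    \<comment> \<open>Maximality collapses \<open>X\<close> to \<open>H\<close>, so \<open>x\<close>
      itself lies in \<open>H\<close> and x = x + 0 is a decomposition after all.\<close>
    from max[OF this HX] have XH: "X = H" .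
    have "x \<in> X" using XI[OF HD(3), of "\<one>\<^bsub>k\<^esub>"] x by simp
    then have "x \<in> H" using XH by blast
    then show False using nd KD(3) x V.r_zero by metis
  qed
  then show thesis using that H HK by blast
qed

text \<open>Project along a complement \<open>H\<close>. Two decompositions of one vector differ by
  y' - y = h - h', which lies in both \<open>H\<close> and \<open>K\<close> and so is zero; hence
  the \<open>K\<close>-component is unique, and uniqueness also makes it linear.\<close>

lemma linear_projection_exists:
  assumes k: "field k" and V: "Module.module k V" and K: "submodule K k V"
  obtains \<pi> where "linear_map k V V \<pi>" "\<And>x. x \<in> carrier V \<Longrightarrow> \<pi> x \<in> K" "\<And>x. x \<in> K \<Longrightarrow> \<pi> x = x"
proof -
  interpret V: Module.module k V by fact
  note KD = submoduleD[OF V K]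
  obtain H where H: "submodule H k V" and HK: "H \<inter> K = {\<zero>\<^bsub>V\<^esub>}"
    and sum: "\<And>x. x \<in> carrier V \<Longrightarrow> \<exists>h\<in>H. \<exists>y\<in>K. x = h \<oplus>\<^bsub>V\<^esub> y"
    by (rule submodule_complement_exists[OF assms]) (rule that)
  note HD = submoduleD[OF V H]
  have uniq: "y = y'" if "h \<in> H" "h' \<in> H" "y \<in> K" "y' \<in> K" "h \<oplus>\<^bsub>V\<^esub> y = h' \<oplus>\<^bsub>V\<^esub> y'" for h h' y y'
  proof -
    have c: "h \<in> carrier V" "h' \<in> carrier V" "y \<in> carrier V" "y' \<in> carrier V"
      using that HD KD by auto
    have "y' = \<ominus>\<^bsub>V\<^esub> h' \<oplus>\<^bsub>V\<^esub> (h \<oplus>\<^bsub>V\<^esub> y)"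
      unfolding that(5) using c by (simp add: V.r_neg1)
    then have "y' \<ominus>\<^bsub>V\<^esub> y = h \<ominus>\<^bsub>V\<^esub> h'"
      using c by (simp add: V.minus_eq V.a_assoc V.r_neg) (rule V.a_comm; simp)
    then have "y' \<ominus>\<^bsub>V\<^esub> y \<in> H \<inter> K" using HD(5) KD(5) that by force
    then show ?thesis using HK c by (auto simp: V.minus_eq_zero_iff)
  qed
  define \<pi> where "\<pi> x = (THE y. y \<in> K \<and> (\<exists>h\<in>H. x = h \<oplus>\<^bsub>V\<^esub> y))" for x
  have \<pi>I: "\<pi> (h \<oplus>\<^bsub>V\<^esub> y) = y" if "h \<in> H" "y \<in> K" for h y
    unfolding \<pi>_def using that uniq by (intro the_equality) blast+
  have "linear_map k V V \<pi>"
    unfolding linear_map_def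
  proof (intro conjI ballI funcsetI)
    fix x assume "x \<in> carrier V"
    from sum[OF this] obtain h y where x: "x = h \<oplus>\<^bsub>V\<^esub> y" and h: "h \<in> H" and y: "y \<in> K" by blast
    have c: "h \<in> carrier V" "y \<in> carrier V" using h y HD KD by auto
    show "\<pi> x \<in> carrier V" using x h y c \<pi>I by simp
    show "\<pi> (a \<odot>\<^bsub>V\<^esub> x) = a \<odot>\<^bsub>V\<^esub> \<pi> x" if a: "a \<in> carrier k" for a
      using \<pi>I[OF HD(6)[OF a h] KD(6)[OF a y]] \<pi>I[OF h y] x a c by (simp add: V.smult_r_distr)
    fix x' assume "x' \<in> carrier V"
    from sum[OF this] obtain h' y' where x': "x' = h' \<oplus>\<^bsub>V\<^esub> y'" and h': "h' \<in> H" and y': "y' \<in> K" by blast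
    have c': "h' \<in> carrier V" "y' \<in> carrier V" using h' y' HD KD by auto
    show "\<pi> (x \<oplus>\<^bsub>V\<^esub> x') = \<pi> x \<oplus>\<^bsub>V\<^esub> \<pi> x'"
      using \<pi>I[OF HD(4)[OF h h'] KD(4)[OF y y']] \<pi>I[OF h y] \<pi>I[OF h' y'] x x' c c'
      by (simp add: V.a_ac)
  qed
  moreover have "\<pi> x \<in> K" if "x \<in> carrier V" for x using sum[OF that] \<pi>I by auto
  moreover have "\<pi> x = x" if "x \<in> K" for x using \<pi>I[OF HD(3) that] KD(2)[OF that] by simp
  ultimately show thesis by (rule that)
qed

text \<open>Project the target onto the image by \<rho>, choose preimages, and correct the choice by
  a map \<sigma> that kills the kernel of \<open>g\<close>. The choice alone need not be linear;
  after \<sigma> it no longer matters, and linearity appears.\<close>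

lemma linear_generalized_inverse_exists:
  assumes k: "field k" and V: "Module.module k V" and W: "Module.module k W"
    and g: "linear_map k V W g"
  obtains q where "linear_map k W V q" "\<And>x. x \<in> carrier V \<Longrightarrow> g (q (g x)) = g x"
proof -
  interpret V: Module.module k V by fact
  interpret W: Module.module k W by fact
  note L = linear_mapD[OF g]
  let ?K = "{x \<in> carrier V. g x \<in> {\<zero>\<^bsub>W\<^esub>}}"
  obtain \<pi> where \<pi>: "linear_map k V V \<pi>" "\<And>x. x \<in> carrier V \<Longrightarrow> \<pi> x \<in> ?K" "\<And>x. x \<in> ?K \<Longrightarrow> \<pi> x = x"
    by (rule linear_projection_exists[OF k V submodule_vimage[OF V W g submodule_zero[OF W]]]) (rule that)
  obtain \<rho> where \<rho>: "linear_map k W W \<rho>" "\<And>x. x \<in> carrier W \<Longrightarrow> \<rho> x \<in> g ` carrier V"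
      "\<And>x. x \<in> g ` carrier V \<Longrightarrow> \<rho> x = x"
    by (rule linear_projection_exists[OF k W submodule_image[OF V W g]]) (rule that)
  \<comment> \<open>Since \<pi> is the identity on the kernel of \<open>g\<close> and takes all its
    values there, \<sigma> vanishes on the kernel while g \<sigma> = g.\<close>
  define \<sigma> where "\<sigma> x = x \<ominus>\<^bsub>V\<^esub> \<pi> x" for x
  have \<sigma>: "linear_map k V V \<sigma>"
    unfolding \<sigma>_def by (rule linear_map_diff[OF V linear_map_id \<pi>(1)])
  note \<sigma>D = linear_mapD[OF \<sigma>]
  have \<sigma>eq: "\<sigma> x = \<sigma> y" if "x \<in> carrier V" "y \<in> carrier V" "g x = g y" for x y
  proof -
    have "x \<ominus>\<^bsub>V\<^esub> y \<in> ?K"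
      using that L(1) by (simp add: linear_map_minus[OF V W g] W.r_neg W.minus_eq)
    then have "\<sigma> (x \<ominus>\<^bsub>V\<^esub> y) = \<zero>\<^bsub>V\<^esub>" using \<pi>(3) that by (simp add: \<sigma>_def V.minus_eq V.r_neg)
    then show ?thesis using linear_map_minus[OF V V \<sigma> that(1,2)] \<sigma>D(1) that
      by (simp add: V.minus_eq_zero_iff)
  qed
  \<comment> \<open>An arbitrary preimage of \<rho> c; the projection \<rho> guarantees that one
    exists even when \<open>c\<close> is outside the image of \<open>g\<close>.\<close>
  define s where "s c = (SOME b. b \<in> carrier V \<and> g b = \<rho> c)" for c
  have s: "s c \<in> carrier V" "g (s c) = \<rho> c" if "c \<in> carrier W" for c
  proof -
    have "\<exists>b. b \<in> carrier V \<and> g b = \<rho> c" using \<rho>(2)[OF that] by auto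
    from someI_ex[OF this] show "s c \<in> carrier V" "g (s c) = \<rho> c" unfolding s_def by auto
  qed
  note R = linear_mapD[OF \<rho>(1)]
  have "linear_map k W V (\<lambda>c. \<sigma> (s c))"
    unfolding linear_map_def
  proof (intro conjI ballI funcsetI)
    fix x assume x: "x \<in> carrier W"
    show "\<sigma> (s x) \<in> carrier V" using \<sigma>D(1) s(1) x by blast
    show "\<sigma> (s (c \<odot>\<^bsub>W\<^esub> x)) = c \<odot>\<^bsub>V\<^esub> \<sigma> (s x)" if c: "c \<in> carrier k" for c
      using \<sigma>eq[of "s (c \<odot>\<^bsub>W\<^esub> x)" "c \<odot>\<^bsub>V\<^esub> s x"] c x s L R \<sigma>D by simp
    show "\<sigma> (s (x \<oplus>\<^bsub>W\<^esub> y)) = \<sigma> (s x) \<oplus>\<^bsub>V\<^esub> \<sigma> (s y)" if y: "y \<in> carrier W" for y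
      using \<sigma>eq[of "s (x \<oplus>\<^bsub>W\<^esub> y)" "s x \<oplus>\<^bsub>V\<^esub> s y"] y x s L R \<sigma>D by simp
  qed
  moreover have "g (\<sigma> (s (g x))) = g x" if x: "x \<in> carrier V" for x
  proof -
    have "g (\<sigma> (s (g x))) = g (s (g x)) \<ominus>\<^bsub>W\<^esub> g (\<pi> (s (g x)))"
      unfolding \<sigma>_def using s L x \<pi>(2) by (intro linear_map_minus[OF V W g]) auto
    also have "\<dots> = \<rho> (g x)" using s L x \<pi>(2) R by (simp add: W.minus_eq)
    also have "\<dots> = g x" using \<rho>(3) x by simp
    finally show ?thesis .
  qed
  ultimately show thesis by (rule that)
qed

text \<open>With generalized inverses \<open>q\<close> of \<open>g\<close> and p' of
  \<open>f\<close>, the vector x - q g x is killed by \<open>g\<close>, hence lies in the image of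
  \<open>f\<close>, where f p' is the identity. So p = p' (id - q g) works.\<close>

lemma exact_pair_splits:
  assumes k: "field k" and A: "Module.module k A" and B: "Module.module k B" and C: "Module.module k C"
    and f: "linear_map k A B f" and g: "linear_map k B C g"
    and ex: "f ` carrier A = {x \<in> carrier B. g x = \<zero>\<^bsub>C\<^esub>}"
  obtains p q where "linear_map k B A p" "linear_map k C B q"
    "\<And>x. x \<in> carrier B \<Longrightarrow> f (p x) \<oplus>\<^bsub>B\<^esub> q (g x) = x"
proof -
  interpret B: Module.module k B by fact
  interpret C: Module.module k C by fact
  obtain p where p: "linear_map k B A p" "\<And>x. x \<in> carrier A \<Longrightarrow> f (p (f x)) = f x"
    by (rule linear_generalized_inverse_exists[OF k A B f]) (rule that)
  obtain q where q: "linear_map k C B q" "\<And>x. x \<in> carrier B \<Longrightarrow> g (q (g x)) = g x"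
    by (rule linear_generalized_inverse_exists[OF k B C g]) (rule that)
  note D = linear_mapD(1)[OF f] linear_mapD(1)[OF g] linear_mapD(1)[OF p(1)] linear_mapD(1)[OF q(1)]
  have d: "linear_map k B B (\<lambda>x. x \<ominus>\<^bsub>B\<^esub> q (g x))"
    by (rule linear_map_diff[OF B linear_map_id linear_map_comp[OF g q(1)]])
  have "f (p (x \<ominus>\<^bsub>B\<^esub> q (g x))) \<oplus>\<^bsub>B\<^esub> q (g x) = x" if x: "x \<in> carrier B" for x
  proof -
    have "g (x \<ominus>\<^bsub>B\<^esub> q (g x)) = \<zero>\<^bsub>C\<^esub>"
      using x D q(2) by (simp add: linear_map_minus[OF B C g] C.minus_eq C.r_neg)
    then have "x \<ominus>\<^bsub>B\<^esub> q (g x) \<in> f ` carrier A" using x D ex by simp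
    then have "f (p (x \<ominus>\<^bsub>B\<^esub> q (g x))) = x \<ominus>\<^bsub>B\<^esub> q (g x)" using p(2) by auto
    then show ?thesis using x D by (simp add: B.minus_eq B.a_assoc B.l_neg)
  qed
  then show thesis by (rule that[OF linear_map_comp[OF d p(1)] q(1)])
qed

subsection \<open>Linear maps on tensor products\<close>

lemma abelian_subgroup_submodule:
  assumes V: "Module.module k V" and K: "submodule K k V"
  shows "abelian_subgroup K V"
  using submodule.axioms(1)[OF K] module.axioms(2)[OF V]
  by (intro abelian_subgroupI3 additive_subgroupI)

lemma a_rcos_eq_iff:
  assumes V: "Module.module k V" and K: "submodule K k V" and x: "x \<in> carrier V" and y: "y \<in> carrier V"
  shows "K +>\<^bsub>V\<^esub> x = K +>\<^bsub>V\<^esub> y \<longleftrightarrow> x \<ominus>\<^bsub>V\<^esub> y \<in> K"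
proof -
  interpret Module.module k V by fact
  interpret K: abelian_subgroup K V by (rule abelian_subgroup_submodule[OF V K])
  note KD = submoduleD[OF V K]
  have dec: "x = (x \<ominus>\<^bsub>V\<^esub> y) \<oplus>\<^bsub>V\<^esub> y" using x y by (simp add: minus_eq a_assoc l_neg)
  show ?thesis
  proof
    assume "K +>\<^bsub>V\<^esub> x = K +>\<^bsub>V\<^esub> y"
    then have "x \<in> K +>\<^bsub>V\<^esub> y" using K.a_rcos_self[OF x] by simp
    then obtain h where h: "h \<in> K" "x = h \<oplus>\<^bsub>V\<^esub> y" by (auto simp: a_r_coset_def')
    then have "x \<ominus>\<^bsub>V\<^esub> y = h" using KD(2) y by (simp add: minus_eq a_assoc r_neg)
    then show "x \<ominus>\<^bsub>V\<^esub> y \<in> K" using h by simp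
  next
    assume "x \<ominus>\<^bsub>V\<^esub> y \<in> K"
    then have "x \<in> K +>\<^bsub>V\<^esub> y" using dec unfolding a_r_coset_def' by blast
    then show "K +>\<^bsub>V\<^esub> x = K +>\<^bsub>V\<^esub> y"
      using a_repr_independence[OF _ y K.a_subgroup] by simp
  qed
qed

text \<open>Scalar multiplication on a quotient and \<open>tensor_map\<close> are defined as unions
  over all representatives of a coset. Once the value is independent of the representative, the
  union collapses to it.\<close>

lemma UN_a_rcos:
  assumes V: "Module.module k V" and K: "submodule K k V" and x: "x \<in> carrier V"
    and F: "\<And>z. z \<in> carrier V \<Longrightarrow> z \<ominus>\<^bsub>V\<^esub> x \<in> K \<Longrightarrow> F z = F x"
  shows "(\<Union>z\<in>K +>\<^bsub>V\<^esub> x. F z) = F x"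
proof -
  interpret Module.module k V by fact
  interpret K: abelian_subgroup K V by (rule abelian_subgroup_submodule[OF V K])
  have "F z = F x" if z: "z \<in> K +>\<^bsub>V\<^esub> x" for z
  proof -
    have zc: "z \<in> carrier V" using a_r_coset_subset_G[OF K.a_subset x] z by blast
    have "K +>\<^bsub>V\<^esub> z = K +>\<^bsub>V\<^esub> x"
      using a_repr_independence[OF z x K.a_subgroup] by simp
    then show ?thesis using F zc a_rcos_eq_iff[OF V K zc x] by blast
  qed
  then show ?thesis using K.a_rcos_self[OF x] by blast
qed

lemma quotient_module_simps:
  assumes V: "Module.module k V" and K: "submodule K k V"
  shows "carrier (quotient_module k V K) = (\<lambda>x. K +>\<^bsub>V\<^esub> x) ` carrier V"
    and "\<zero>\<^bsub>quotient_module k V K\<^esub> = K"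
    and "x \<in> carrier V \<Longrightarrow> y \<in> carrier V \<Longrightarrow>
      (K +>\<^bsub>V\<^esub> x) \<oplus>\<^bsub>quotient_module k V K\<^esub> (K +>\<^bsub>V\<^esub> y) = K +>\<^bsub>V\<^esub> (x \<oplus>\<^bsub>V\<^esub> y)"
    and "c \<in> carrier k \<Longrightarrow> x \<in> carrier V \<Longrightarrow>
      c \<odot>\<^bsub>quotient_module k V K\<^esub> (K +>\<^bsub>V\<^esub> x) = K +>\<^bsub>V\<^esub> (c \<odot>\<^bsub>V\<^esub> x)"
proof -
  interpret Module.module k V by fact
  interpret K: abelian_subgroup K V by (rule abelian_subgroup_submodule[OF V K])
  note KD = submoduleD[OF V K]
  show "carrier (quotient_module k V K) = (\<lambda>x. K +>\<^bsub>V\<^esub> x) ` carrier V"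
    by (auto simp: quotient_module_def A_RCOSETS_def')
  show "\<zero>\<^bsub>quotient_module k V K\<^esub> = K" by (simp add: quotient_module_def)
  show "(K +>\<^bsub>V\<^esub> x) \<oplus>\<^bsub>quotient_module k V K\<^esub> (K +>\<^bsub>V\<^esub> y) = K +>\<^bsub>V\<^esub> (x \<oplus>\<^bsub>V\<^esub> y)"
    if "x \<in> carrier V" "y \<in> carrier V"
    using K.a_rcos_sum[OF that] by (simp add: quotient_module_def)
  show "c \<odot>\<^bsub>quotient_module k V K\<^esub> (K +>\<^bsub>V\<^esub> x) = K +>\<^bsub>V\<^esub> (c \<odot>\<^bsub>V\<^esub> x)"
    if c: "c \<in> carrier k" and x: "x \<in> carrier V"
  proof -
    have "K +>\<^bsub>V\<^esub> (c \<odot>\<^bsub>V\<^esub> z) = K +>\<^bsub>V\<^esub> (c \<odot>\<^bsub>V\<^esub> x)" if z: "z \<in> carrier V" "z \<ominus>\<^bsub>V\<^esub> x \<in> K" for z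
    proof -
      have "c \<odot>\<^bsub>V\<^esub> z \<ominus>\<^bsub>V\<^esub> c \<odot>\<^bsub>V\<^esub> x = c \<odot>\<^bsub>V\<^esub> (z \<ominus>\<^bsub>V\<^esub> x)"
        using c x z by (simp add: minus_eq smult_r_distr smult_r_minus)
      then show ?thesis using KD(6)[OF c z(2)] a_rcos_eq_iff[OF V K] c x z by simp
    qed
    from UN_a_rcos[where F = "\<lambda>z. K +>\<^bsub>V\<^esub> (c \<odot>\<^bsub>V\<^esub> z)", OF V K x this] show ?thesis by (simp add: quotient_module_def)
  qed
qed

lemma linear_map_a_rcos:
  assumes V: "Module.module k V" and K: "submodule K k V"
  shows "linear_map k V (quotient_module k V K) (\<lambda>x. K +>\<^bsub>V\<^esub> x)"
  unfolding linear_map_def using quotient_module_simps[OF assms] by auto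

lemma module_quotient_module:
  assumes V: "Module.module k V" and K: "submodule K k V"
  shows "Module.module k (quotient_module k V K)"
proof -
  interpret Module.module k V by fact
  note Q = quotient_module_simps[OF assms]
  \<comment> \<open>Writing zero as the coset of zero gives every element the form
    \<open>K + x\<close>, so that the module laws are inherited from representatives.\<close>
  have K0: "K = K +>\<^bsub>V\<^esub> \<zero>\<^bsub>V\<^esub>" using a_coset_add_zero[OF submoduleD(1)[OF assms]] by simp
  have Q0: "\<zero>\<^bsub>quotient_module k V K\<^esub> = K +>\<^bsub>V\<^esub> \<zero>\<^bsub>V\<^esub>" using Q(2) K0 by simp
  show ?thesis
  proof (rule moduleI[OF is_cring])
    show "abelian_group (quotient_module k V K)"
    proof (rule abelian_groupI)
      fix X assume "X \<in> carrier (quotient_module k V K)"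
      then obtain x where x: "X = K +>\<^bsub>V\<^esub> x" "x \<in> carrier V" by (auto simp: Q(1))
      show "\<exists>Y\<in>carrier (quotient_module k V K). Y \<oplus>\<^bsub>quotient_module k V K\<^esub> X = \<zero>\<^bsub>quotient_module k V K\<^esub>"
        by (rule bexI[of _ "K +>\<^bsub>V\<^esub> (\<ominus>\<^bsub>V\<^esub> x)"]) (use x in \<open>auto simp: Q(1,3) Q0 l_neg\<close>)
    qed (auto simp: Q(1,3) Q0 a_ac)
  qed (auto simp: Q(1,3,4) smult_l_distr smult_r_distr smult_assoc1)
qed

section \<open>Spans and maps of free modules\<close>

lemma module_span_least:
  assumes "submodule H k V" "S \<subseteq> H"
  shows "module_span k V S \<subseteq> H"
  using assms by (auto simp: module_span_def)

lemma module_span_superset: "S \<subseteq> module_span k V S"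
  by (auto simp: module_span_def)

text \<open>The inclusion of \<open>S\<close> in the carrier makes the intersected family nonempty,
  as it contains the whole module; an empty intersection would be the entire type.\<close>

lemma submodule_module_span:
  assumes V: "Module.module k V" and S: "S \<subseteq> carrier V"
  shows "submodule (module_span k V S) k V"
proof -
  have *: "submodule (carrier V) k V" by (rule module.carrier_is_submodule[OF V])
  have "module_span k V S \<subseteq> carrier V" by (rule module_span_least[OF * S])
  then show ?thesis
    unfolding submodule_iff[OF V] by (auto simp: module_span_def dest: submoduleD[OF V])
qed

text \<open>Evaluation at \<open>t\<close> is additive, so it passes through finite sums; over an
  infinite index set both sides are zero by convention.\<close>

lemma finsum_free_module_apply:
  assumes k: "cring k" and F: "\<And>s. s \<in> A \<Longrightarrow> F s \<in> carrier (free_module k T)"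
  shows "(\<Oplus>\<^bsub>free_module k T\<^esub>s\<in>A. F s) t = (\<Oplus>\<^bsub>k\<^esub>s\<in>A. F s t)"
proof -
  interpret k: cring k by fact
  interpret M: Module.module k "free_module k T" by (rule module_free_module[OF k])
  have Fk: "F s t \<in> carrier k" if "s \<in> A" for s using F[OF that] by (simp add: free_module_carrier)
  show ?thesis
    using F Fk
  proof (induction A rule: infinite_finite_induct)
    case (insert a A)
    then show ?case by (simp add: free_module_simps(2) Pi_def)
  qed (simp_all add: free_module_simps(1))
qed

text \<open>Evaluated at \<open>t\<close>, the term of \<open>s\<close> contributes \<phi> s if h s
  = t and zero otherwise, so the sum over the support shrinks to a sum over a fibre. This brings
  \<open>free_push\<close> under the universal property of free modules.\<close>

lemma free_push_eq_free_ext: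
  assumes k: "cring k" and h: "\<And>s. s \<in> S \<Longrightarrow> h s \<in> T" and \<phi>: "\<phi> \<in> carrier (free_module k S)"
  shows "free_push k h \<phi> = free_ext (free_module k T) k (\<lambda>s. free_gen k (h s)) \<phi>"
proof
  fix t
  interpret k: cring k by fact
  interpret M: Module.module k "free_module k T" by (rule module_free_module[OF k])
  let ?A = "{s. \<phi> s \<noteq> \<zero>\<^bsub>k\<^esub>}"
  have \<phi>D: "\<phi> s \<in> carrier k" "s \<in> ?A \<Longrightarrow> h s \<in> T" "finite ?A" for s
    using \<phi> h by (auto simp: free_module_carrier)
  have g: "\<phi> s \<odot>\<^bsub>free_module k T\<^esub> free_gen k (h s) \<in> carrier (free_module k T)" if "s \<in> ?A" for s
    by (intro M.smult_closed \<phi>D(1) free_gen_closed[OF k] \<phi>D(2) that)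
  have "free_ext (free_module k T) k (\<lambda>s. free_gen k (h s)) \<phi> t =
      (\<Oplus>\<^bsub>k\<^esub>s\<in>?A. (\<phi> s \<odot>\<^bsub>free_module k T\<^esub> free_gen k (h s)) t)"
    unfolding free_ext_def by (rule finsum_free_module_apply[OF k g])
  also have "\<dots> = free_push k h \<phi> t"
    unfolding free_push_def
    by (rule k.add.finprod_mono_neutral_cong_right)
      (use \<phi>D in \<open>auto simp: free_module_simps free_gen_def\<close>)
  finally show "free_push k h \<phi> t = free_ext (free_module k T) k (\<lambda>s. free_gen k (h s)) \<phi> t" ..
qed

lemma free_push:
  assumes k: "cring k" and h: "\<And>s. s \<in> S \<Longrightarrow> h s \<in> T"
  shows "linear_map k (free_module k S) (free_module k T) (free_push k h)"
    and "s \<in> S \<Longrightarrow> free_push k h (free_gen k s) = free_gen k (h s)"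
proof -
  interpret M: Module.module k "free_module k S" by (rule module_free_module[OF k])
  have g: "free_gen k (h s) \<in> carrier (free_module k T)" if "s \<in> S" for s
    by (rule free_gen_closed[OF k h[OF that]])
  note E = free_ext[OF module_free_module[OF k] g]
  note P = free_push_eq_free_ext[of k S h T, OF k h]
  show "linear_map k (free_module k S) (free_module k T) (free_push k h)"
    using E(1) unfolding linear_map_def by (simp add: P Pi_def)
  show "free_push k h (free_gen k s) = free_gen k (h s)" if s: "s \<in> S"
    using P[OF _ free_gen_closed[OF k s]] E(2)[OF _ s] by simp
qed

section \<open>Bilinear maps and pure tensors\<close>

definition bilinear_map ::
  "'k ring \<Rightarrow> ('k, 'v) module \<Rightarrow> ('k, 'w) module \<Rightarrow> ('k, 'u) module \<Rightarrow> ('v \<Rightarrow> 'w \<Rightarrow> 'u) \<Rightarrow> bool" where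
  "bilinear_map k V W U b \<longleftrightarrow>
     (\<forall>y\<in>carrier W. linear_map k V U (\<lambda>x. b x y)) \<and> (\<forall>x\<in>carrier V. linear_map k W U (b x))"

definition pure_tensor ::
  "'k ring \<Rightarrow> ('k, 'v) module \<Rightarrow> ('k, 'w) module \<Rightarrow> 'v \<Rightarrow> 'w \<Rightarrow> ('v \<times> 'w \<Rightarrow> 'k) set" where
  "pure_tensor k V W x y = tensor_kernel k V W +>\<^bsub>tensor_free k V W\<^esub> free_gen k (x, y)"

context
  fixes k :: "'k ring" and V :: "('k, 'v) module" and W :: "('k, 'w) module"
  assumes V: "Module.module k V" and W: "Module.module k W"
begin

interpretation V: Module.module k V by (rule V)
interpretation W: Module.module k W by (rule W)
interpretation F: Module.module k "tensor_free k V W"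
  unfolding tensor_free_def by (rule module_free_module[OF V.R.is_cring])

lemma tensor_gen_closed:
  "x \<in> carrier V \<Longrightarrow> y \<in> carrier W \<Longrightarrow> free_gen k (x, y) \<in> carrier (tensor_free k V W)"
  unfolding tensor_free_def by (rule free_gen_closed[OF V.R.is_cring]) simp

lemma tensor_relations_subset: "tensor_relations k V W \<subseteq> carrier (tensor_free k V W)"
  unfolding tensor_relations_def
  by (auto intro!: tensor_gen_closed)

lemma submodule_tensor_kernel: "submodule (tensor_kernel k V W) k (tensor_free k V W)"
  unfolding tensor_kernel_def
  by (rule submodule_module_span[OF F.module_axioms tensor_relations_subset])

lemmas tensor_quotient = quotient_module_simps[OF F.module_axioms submodule_tensor_kernel,
    folded tensor_module_def]

lemma module_tensor_module: "Module.module k (tensor_module k V W)"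
  unfolding tensor_module_def by (rule module_quotient_module[OF F.module_axioms submodule_tensor_kernel])

lemma linear_map_tensor_coset:
  "linear_map k (tensor_free k V W) (tensor_module k V W)
     (\<lambda>\<phi>. tensor_kernel k V W +>\<^bsub>tensor_free k V W\<^esub> \<phi>)"
  unfolding tensor_module_def by (rule linear_map_a_rcos[OF F.module_axioms submodule_tensor_kernel])

lemma tensor_coset_eq:
  assumes "\<phi> \<in> carrier (tensor_free k V W)" "\<psi> \<in> carrier (tensor_free k V W)"
    and "\<phi> \<ominus>\<^bsub>tensor_free k V W\<^esub> \<psi> \<in> tensor_relations k V W"
  shows "tensor_kernel k V W +>\<^bsub>tensor_free k V W\<^esub> \<phi> = tensor_kernel k V W +>\<^bsub>tensor_free k V W\<^esub> \<psi>"
  unfolding a_rcos_eq_iff[OF F.module_axioms submodule_tensor_kernel assms(1,2)]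
  unfolding tensor_kernel_def by (rule subsetD[OF module_span_superset assms(3)])

text \<open>Each of the four identities is one family of \<open>tensor_relations\<close>, read
  modulo the kernel.\<close>

lemma bilinear_pure_tensor: "bilinear_map k V W (tensor_module k V W) (pure_tensor k V W)"
proof -
  note L = linear_mapD[OF linear_map_tensor_coset]
  note gen = tensor_gen_closed
  show ?thesis
    unfolding bilinear_map_def linear_map_def pure_tensor_def
  proof (intro conjI ballI funcsetI)
    fix x y assume x: "x \<in> carrier V" and y: "y \<in> carrier W"
    show "tensor_kernel k V W +>\<^bsub>tensor_free k V W\<^esub> free_gen k (x, y) \<in> carrier (tensor_module k V W)"
      by (rule L(1)[OF gen[OF x y]])
    then show "tensor_kernel k V W +>\<^bsub>tensor_free k V W\<^esub> free_gen k (x, y) \<in> carrier (tensor_module k V W)" .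
    fix c assume c: "c \<in> carrier k"
    show "tensor_kernel k V W +>\<^bsub>tensor_free k V W\<^esub> free_gen k (c \<odot>\<^bsub>V\<^esub> x, y) =
        c \<odot>\<^bsub>tensor_module k V W\<^esub> (tensor_kernel k V W +>\<^bsub>tensor_free k V W\<^esub> free_gen k (x, y))"
      unfolding L(3)[OF c gen[OF x y], symmetric]
      by (rule tensor_coset_eq) (use x y c in \<open>auto simp: tensor_relations_def intro!: gen\<close>)
    show "tensor_kernel k V W +>\<^bsub>tensor_free k V W\<^esub> free_gen k (x, c \<odot>\<^bsub>W\<^esub> y) =
        c \<odot>\<^bsub>tensor_module k V W\<^esub> (tensor_kernel k V W +>\<^bsub>tensor_free k V W\<^esub> free_gen k (x, y))"
      unfolding L(3)[OF c gen[OF x y], symmetric]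
      by (rule tensor_coset_eq) (use x y c in \<open>auto simp: tensor_relations_def intro!: gen\<close>)
  next
    fix x x' y assume x: "x \<in> carrier V" and x': "x' \<in> carrier V" and y: "y \<in> carrier W"
    show "tensor_kernel k V W +>\<^bsub>tensor_free k V W\<^esub> free_gen k (x \<oplus>\<^bsub>V\<^esub> x', y) =
       (tensor_kernel k V W +>\<^bsub>tensor_free k V W\<^esub> free_gen k (x, y)) \<oplus>\<^bsub>tensor_module k V W\<^esub>
       (tensor_kernel k V W +>\<^bsub>tensor_free k V W\<^esub> free_gen k (x', y))"
      unfolding L(2)[OF gen[OF x y] gen[OF x' y], symmetric]
      by (rule tensor_coset_eq) (use x x' y in \<open>auto simp: tensor_relations_def intro!: gen\<close>)
  next
    fix x y y' assume x: "x \<in> carrier V" and y: "y \<in> carrier W" and y': "y' \<in> carrier W"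
    show "tensor_kernel k V W +>\<^bsub>tensor_free k V W\<^esub> free_gen k (x, y \<oplus>\<^bsub>W\<^esub> y') =
       (tensor_kernel k V W +>\<^bsub>tensor_free k V W\<^esub> free_gen k (x, y)) \<oplus>\<^bsub>tensor_module k V W\<^esub>
       (tensor_kernel k V W +>\<^bsub>tensor_free k V W\<^esub> free_gen k (x, y'))"
      unfolding L(2)[OF gen[OF x y] gen[OF x y'], symmetric]
      by (rule tensor_coset_eq) (use x y y' in \<open>auto simp: tensor_relations_def intro!: gen\<close>)
  qed
qed

text \<open>Bilinearity on generators says precisely that \<open>l\<close> kills each relation. The
  null space of \<open>l\<close> is then a submodule containing the relations, hence their span.
  This is what lets \<open>l\<close> descend to the tensor product.\<close>

lemma tensor_kernel_vanish:
  assumes U: "Module.module k U" and L: "linear_map k (tensor_free k V W) U l"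
    and b: "bilinear_map k V W U (\<lambda>x y. l (free_gen k (x, y)))" and \<phi>: "\<phi> \<in> tensor_kernel k V W"
  shows "l \<phi> = \<zero>\<^bsub>U\<^esub>"
proof -
  interpret U: Module.module k U by fact
  note LD = linear_mapD[OF L] and m = linear_map_minus[OF F.module_axioms U L]
  note gen = tensor_gen_closed
  have bD: "linear_map k V U (\<lambda>x. l (free_gen k (x, y)))" if "y \<in> carrier W" for y
    using b that by (simp add: bilinear_map_def)
  have bE: "linear_map k W U (\<lambda>y. l (free_gen k (x, y)))" if "x \<in> carrier V" for x
    using b that by (simp add: bilinear_map_def)
  note B = linear_mapD(2,3)[OF bD] linear_mapD(2,3)[OF bE]
  have "tensor_relations k V W \<subseteq> {\<phi> \<in> carrier (tensor_free k V W). l \<phi> \<in> {\<zero>\<^bsub>U\<^esub>}}"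
  proof
    fix r assume r: "r \<in> tensor_relations k V W"
    then have "l r = \<zero>\<^bsub>U\<^esub>"
      unfolding tensor_relations_def
      by (elim UnE CollectE exE conjE; hypsubst)
        (simp_all add: m LD gen B U.r_neg U.minus_eq_zero_iff)
    then show "r \<in> {\<phi> \<in> carrier (tensor_free k V W). l \<phi> \<in> {\<zero>\<^bsub>U\<^esub>}}"
      using r tensor_relations_subset by blast
  qed
  from module_span_least[OF submodule_vimage[OF F.module_axioms U L submodule_zero[OF U]] this] \<phi>
  show ?thesis unfolding tensor_kernel_def by blast
qed

text \<open>Pulled back along the surjective coset map, both sides become linear maps on a free
  module, determined by the generators, whose cosets are the pure tensors.\<close>

lemma tensor_linear_eqI:
  assumes U: "Module.module k U" and f: "linear_map k (tensor_module k V W) U f"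
    and g: "linear_map k (tensor_module k V W) U g"
    and eq: "\<And>x y. x \<in> carrier V \<Longrightarrow> y \<in> carrier W \<Longrightarrow> f (pure_tensor k V W x y) = g (pure_tensor k V W x y)"
    and X: "X \<in> carrier (tensor_module k V W)"
  shows "f X = g X"
proof -
  obtain \<phi> where \<phi>: "\<phi> \<in> carrier (tensor_free k V W)"
      "X = tensor_kernel k V W +>\<^bsub>tensor_free k V W\<^esub> \<phi>"
    using X unfolding tensor_quotient(1) by blast
  note C = linear_map_tensor_coset
  show ?thesis
    unfolding \<phi>(2)
    by (rule free_linear_eqI[OF V.R.is_cring U linear_map_comp[OF C f, unfolded tensor_free_def]
          linear_map_comp[OF C g, unfolded tensor_free_def] _ \<phi>(1)[unfolded tensor_free_def],
          folded tensor_free_def])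
      (use eq in \<open>auto simp: pure_tensor_def\<close>)
qed

end

section \<open>Functoriality of the tensor product of modules\<close>

lemma bilinear_map_comp:
  assumes b: "bilinear_map k V' W' U b" and f: "linear_map k V V' f" and g: "linear_map k W W' g"
  shows "bilinear_map k V W U (\<lambda>x y. b (f x) (g y))"
  unfolding bilinear_map_def
proof (intro conjI ballI)
  show "linear_map k V U (\<lambda>x. b (f x) (g y))" if "y \<in> carrier W" for y
    using b linear_mapD(1)[OF g that] unfolding bilinear_map_def
    by (intro linear_map_comp[OF f, of U "\<lambda>x. b x (g y)"]) simp
  show "linear_map k W U (\<lambda>y. b (f x) (g y))" if "x \<in> carrier V" for x
    using b linear_mapD(1)[OF f that] unfolding bilinear_map_def
    by (intro linear_map_comp[OF g, of U "b (f x)"]) simp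
qed

context
  fixes k :: "'k ring" and V :: "('k, 'v) module" and W :: "('k, 'w) module"
    and V' :: "('k, 'v2) module" and W' :: "('k, 'w2) module" and f g
  assumes V: "Module.module k V" and W: "Module.module k W"
    and V': "Module.module k V'" and W': "Module.module k W'"
    and f: "linear_map k V V' f" and g: "linear_map k W W' g"
begin

interpretation V: Module.module k V by (rule V)
interpretation F: Module.module k "tensor_free k V W"
  unfolding tensor_free_def by (rule module_free_module[OF V.R.is_cring])
interpretation F': Module.module k "tensor_free k V' W'"
  unfolding tensor_free_def by (rule module_free_module[OF V.R.is_cring])

lemma free_push_tensor:
  "linear_map k (tensor_free k V W) (tensor_free k V' W') (free_push k (map_prod f g))"
  "x \<in> carrier V \<Longrightarrow> y \<in> carrier W \<Longrightarrow>
    free_push k (map_prod f g) (free_gen k (x, y)) = free_gen k (f x, g y)"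
proof -
  have h: "map_prod f g s \<in> carrier V' \<times> carrier W'" if "s \<in> carrier V \<times> carrier W" for s
    using that linear_mapD(1)[OF f] linear_mapD(1)[OF g] by auto
  show "linear_map k (tensor_free k V W) (tensor_free k V' W') (free_push k (map_prod f g))"
    unfolding tensor_free_def by (rule free_push(1)[OF V.R.is_cring h])
  show "free_push k (map_prod f g) (free_gen k (x, y)) = free_gen k (f x, g y)"
    if "x \<in> carrier V" "y \<in> carrier W"
    using free_push(2)[where s = "(x, y)", OF V.R.is_cring h] that by simp
qed

text \<open>Pushing forward and then taking the coset is linear on the free module and bilinear on
  generators, so it kills \<open>tensor_kernel\<close>. It is therefore constant on cosets, and the
  union defining \<open>tensor_map\<close> has a single value.\<close>

lemma tensor_map_coset:
  assumes \<phi>: "\<phi> \<in> carrier (tensor_free k V W)"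
  shows "tensor_map k V' W' f g (tensor_kernel k V W +>\<^bsub>tensor_free k V W\<^esub> \<phi>) =
    tensor_kernel k V' W' +>\<^bsub>tensor_free k V' W'\<^esub> free_push k (map_prod f g) \<phi>"
proof -
  let ?l = "\<lambda>\<phi>. tensor_kernel k V' W' +>\<^bsub>tensor_free k V' W'\<^esub> free_push k (map_prod f g) \<phi>"
  note T' = module_tensor_module[OF V' W']
  interpret T': Module.module k "tensor_module k V' W'" by (rule T')
  have l: "linear_map k (tensor_free k V W) (tensor_module k V' W') ?l"
    by (rule linear_map_comp[OF free_push_tensor(1) linear_map_tensor_coset[OF V' W']])
  have b: "bilinear_map k V W (tensor_module k V' W') (\<lambda>x y. pure_tensor k V' W' (f x) (g y))"
    by (rule bilinear_map_comp[OF bilinear_pure_tensor[OF V' W'] f g])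
  \<comment> \<open>The generator formula for \<open>free_push\<close> is available only for
    arguments in the carriers, so carrying bilinearity over from \<open>b\<close> requires sums and
    multiples to stay there.\<close>
  have bl: "bilinear_map k V W (tensor_module k V' W') (\<lambda>x y. ?l (free_gen k (x, y)))"
    using b V.a_closed module.smult_closed[OF V] abelian_monoid.a_closed[OF abelian_group.axioms(1)[OF module.axioms(2)[OF W]]]
      module.smult_closed[OF W]
    unfolding bilinear_map_def linear_map_def Pi_def
    by (simp add: free_push_tensor(2) pure_tensor_def)
  have "?l \<psi> = ?l \<phi>" if \<psi>: "\<psi> \<in> carrier (tensor_free k V W)"
    and K: "\<psi> \<ominus>\<^bsub>tensor_free k V W\<^esub> \<phi> \<in> tensor_kernel k V W" for \<psi>
    using tensor_kernel_vanish[OF V W T' l bl K] linear_map_minus[OF F.module_axioms T' l \<psi> \<phi>]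
      linear_mapD(1)[OF l] \<phi> \<psi> T'.minus_eq_zero_iff by simp
  from UN_a_rcos[where F = ?l, OF F.module_axioms submodule_tensor_kernel[OF V W] \<phi> this]
  show ?thesis unfolding tensor_map_def .
qed

lemma tensor_map_pure:
  assumes "x \<in> carrier V" "y \<in> carrier W"
  shows "tensor_map k V' W' f g (pure_tensor k V W x y) = pure_tensor k V' W' (f x) (g y)"
  unfolding pure_tensor_def
  using tensor_map_coset[OF tensor_gen_closed[OF V W assms]] free_push_tensor(2)[OF assms] by simp

lemma linear_map_tensor_map:
  "linear_map k (tensor_module k V W) (tensor_module k V' W') (tensor_map k V' W' f g)"
proof -
  note L' = linear_mapD[OF linear_map_tensor_coset[OF V' W']] and P = linear_mapD[OF free_push_tensor(1)]
  show ?thesis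
    unfolding linear_map_def tensor_quotient(1)[OF V W]
    by (auto simp: tensor_quotient(3,4)[OF V W] tensor_map_coset L' P)
qed

end

text \<open>Linear maps are total functions with arbitrary values off the carriers, and laws such as
  those of \<open>res\<close> hold only on carriers. Pure tensors of carrier elements do not see the
  difference.\<close>

lemma tensor_map_cong:
  assumes V: "Module.module k V" and W: "Module.module k W"
    and V': "Module.module k V'" and W': "Module.module k W'"
    and f: "linear_map k V V' f" and g: "linear_map k W W' g"
    and f': "linear_map k V V' f'" and g': "linear_map k W W' g'"
    and eq: "\<And>x. x \<in> carrier V \<Longrightarrow> f x = f' x" "\<And>y. y \<in> carrier W \<Longrightarrow> g y = g' y"
    and X: "X \<in> carrier (tensor_module k V W)"
  shows "tensor_map k V' W' f g X = tensor_map k V' W' f' g' X"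
  by (rule tensor_linear_eqI[OF V W module_tensor_module[OF V' W']
        linear_map_tensor_map[OF V W V' W' f g] linear_map_tensor_map[OF V W V' W' f' g'] _ X])
    (simp add: eq tensor_map_pure[OF V W V' W' f g] tensor_map_pure[OF V W V' W' f' g'])

lemma tensor_map_id:
  assumes V: "Module.module k V" and W: "Module.module k W"
    and X: "X \<in> carrier (tensor_module k V W)"
  shows "tensor_map k V W (\<lambda>x. x) (\<lambda>y. y) X = X"
  by (rule tensor_linear_eqI[OF V W module_tensor_module[OF V W]
        linear_map_tensor_map[OF V W V W linear_map_id linear_map_id] linear_map_id _ X])
    (simp add: tensor_map_pure[OF V W V W linear_map_id linear_map_id])

lemma tensor_map_comp:
  assumes V: "Module.module k V" and W: "Module.module k W"
    and V': "Module.module k V'" and W': "Module.module k W'"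
    and V'': "Module.module k V''" and W'': "Module.module k W''"
    and f: "linear_map k V V' f" and g: "linear_map k W W' g"
    and f': "linear_map k V' V'' f'" and g': "linear_map k W' W'' g'"
    and X: "X \<in> carrier (tensor_module k V W)"
  shows "tensor_map k V'' W'' (\<lambda>x. f' (f x)) (\<lambda>y. g' (g y)) X =
    tensor_map k V'' W'' f' g' (tensor_map k V' W' f g X)"
  by (rule tensor_linear_eqI[OF V W module_tensor_module[OF V'' W'']
        linear_map_tensor_map[OF V W V'' W'' linear_map_comp[OF f f'] linear_map_comp[OF g g']]
        linear_map_comp[OF linear_map_tensor_map[OF V W V' W' f g]
          linear_map_tensor_map[OF V' W' V'' W'' f' g']] _ X])
    (simp add: tensor_map_pure[OF V W V' W' f g] tensor_map_pure[OF V' W' V'' W'' f' g']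
      tensor_map_pure[OF V W V'' W'' linear_map_comp[OF f f'] linear_map_comp[OF g g']]
      linear_mapD(1)[OF f] linear_mapD(1)[OF g])

text \<open>On pure tensors this is additivity of the tensor in its left slot.\<close>

lemma tensor_map_add_left:
  assumes V: "Module.module k V" and W: "Module.module k W"
    and V': "Module.module k V'" and W': "Module.module k W'"
    and f: "linear_map k V V' f" and f': "linear_map k V V' f'" and g: "linear_map k W W' g"
    and X: "X \<in> carrier (tensor_module k V W)"
  shows "tensor_map k V' W' (\<lambda>x. f x \<oplus>\<^bsub>V'\<^esub> f' x) g X =
    tensor_map k V' W' f g X \<oplus>\<^bsub>tensor_module k V' W'\<^esub> tensor_map k V' W' f' g X"
proof -
  note T = module_tensor_module[OF V' W'] and ff = linear_map_add[OF V' f f']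
  show ?thesis
  proof (rule tensor_linear_eqI[OF V W T linear_map_tensor_map[OF V W V' W' ff g]
        linear_map_add[OF T linear_map_tensor_map[OF V W V' W' f g]
          linear_map_tensor_map[OF V W V' W' f' g]] _ X])
    fix x y assume x: "x \<in> carrier V" and y: "y \<in> carrier W"
    have "linear_map k V' (tensor_module k V' W') (\<lambda>x. pure_tensor k V' W' x (g y))"
      using bilinear_pure_tensor[OF V' W'] linear_mapD(1)[OF g y] by (simp add: bilinear_map_def)
    from linear_mapD(2)[OF this linear_mapD(1)[OF f x] linear_mapD(1)[OF f' x]]
    show "tensor_map k V' W' (\<lambda>x. f x \<oplus>\<^bsub>V'\<^esub> f' x) g (pure_tensor k V W x y) =
        tensor_map k V' W' f g (pure_tensor k V W x y) \<oplus>\<^bsub>tensor_module k V' W'\<^esub>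
        tensor_map k V' W' f' g (pure_tensor k V W x y)"
      using tensor_map_pure[OF V W V' W' ff g x y] tensor_map_pure[OF V W V' W' f g x y]
        tensor_map_pure[OF V W V' W' f' g x y] by simp
  qed
qed

lemma tensor_map_add_right:
  assumes V: "Module.module k V" and W: "Module.module k W"
    and V': "Module.module k V'" and W': "Module.module k W'"
    and f: "linear_map k V V' f" and g: "linear_map k W W' g" and g': "linear_map k W W' g'"
    and X: "X \<in> carrier (tensor_module k V W)"
  shows "tensor_map k V' W' f (\<lambda>y. g y \<oplus>\<^bsub>W'\<^esub> g' y) X =
    tensor_map k V' W' f g X \<oplus>\<^bsub>tensor_module k V' W'\<^esub> tensor_map k V' W' f g' X"
proof -
  note T = module_tensor_module[OF V' W'] and gg = linear_map_add[OF W' g g']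
  show ?thesis
  proof (rule tensor_linear_eqI[OF V W T linear_map_tensor_map[OF V W V' W' f gg]
        linear_map_add[OF T linear_map_tensor_map[OF V W V' W' f g]
          linear_map_tensor_map[OF V W V' W' f g']] _ X])
    fix x y assume x: "x \<in> carrier V" and y: "y \<in> carrier W"
    have "linear_map k W' (tensor_module k V' W') (\<lambda>y. pure_tensor k V' W' (f x) y)"
      using bilinear_pure_tensor[OF V' W'] linear_mapD(1)[OF f x] by (simp add: bilinear_map_def)
    from linear_mapD(2)[OF this linear_mapD(1)[OF g y] linear_mapD(1)[OF g' y]]
    show "tensor_map k V' W' f (\<lambda>y. g y \<oplus>\<^bsub>W'\<^esub> g' y) (pure_tensor k V W x y) =
        tensor_map k V' W' f g (pure_tensor k V W x y) \<oplus>\<^bsub>tensor_module k V' W'\<^esub>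
        tensor_map k V' W' f g' (pure_tensor k V W x y)"
      using tensor_map_pure[OF V W V' W' f gg x y] tensor_map_pure[OF V W V' W' f g x y]
        tensor_map_pure[OF V W V' W' f g' x y] by simp
  qed
qed

subsection \<open>Additive functors of vector spaces\<close>

text \<open>This abstracts what tensoring on the left and on the right have in common, so that
  exactness is argued once. \<open>T\<close> receives only the target module, as
  \<open>tensor_map\<close> does.\<close>

locale vector_space_functor =
  fixes k :: "'k ring" and F :: "('k, 'u) module \<Rightarrow> ('k, 'w) module"
    and T :: "('k, 'u) module \<Rightarrow> ('u \<Rightarrow> 'u) \<Rightarrow> 'w \<Rightarrow> 'w"
  assumes field: "field k"
    and F_module: "Module.module k V \<Longrightarrow> Module.module k (F V)"
    and T_linear: "Module.module k V \<Longrightarrow> Module.module k W \<Longrightarrow> linear_map k V W f \<Longrightarrow>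
      linear_map k (F V) (F W) (T W f)"
    and T_cong: "Module.module k V \<Longrightarrow> Module.module k W \<Longrightarrow> linear_map k V W f \<Longrightarrow>
      linear_map k V W g \<Longrightarrow> (\<And>x. x \<in> carrier V \<Longrightarrow> f x = g x) \<Longrightarrow> X \<in> carrier (F V) \<Longrightarrow>
      T W f X = T W g X"
    and T_id: "Module.module k V \<Longrightarrow> X \<in> carrier (F V) \<Longrightarrow> T V (\<lambda>x. x) X = X"
    and T_comp: "Module.module k U \<Longrightarrow> Module.module k V \<Longrightarrow> Module.module k W \<Longrightarrow>
      linear_map k U V f \<Longrightarrow> linear_map k V W g \<Longrightarrow> X \<in> carrier (F U) \<Longrightarrow>
      T W (\<lambda>x. g (f x)) X = T W g (T V f X)"
    and T_add: "Module.module k V \<Longrightarrow> Module.module k W \<Longrightarrow> linear_map k V W f \<Longrightarrow>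
      linear_map k V W g \<Longrightarrow> X \<in> carrier (F V) \<Longrightarrow>
      T W (\<lambda>x. f x \<oplus>\<^bsub>W\<^esub> g x) X = T W f X \<oplus>\<^bsub>F W\<^esub> T W g X"
begin

lemma T_eq_id:
  assumes V: "Module.module k V" and f: "linear_map k V V f"
    and eq: "\<And>x. x \<in> carrier V \<Longrightarrow> f x = x" and X: "X \<in> carrier (F V)"
  shows "T V f X = X"
  using T_cong[OF V V f linear_map_id eq X] T_id[OF V X] by simp

text \<open>A zero map satisfies f + f = f on the carrier, so additivity gives T f + T f = T f, and
  one summand cancels.\<close>

lemma T_eq_zero:
  assumes V: "Module.module k V" and W: "Module.module k W" and f: "linear_map k V W f"
    and eq: "\<And>x. x \<in> carrier V \<Longrightarrow> f x = \<zero>\<^bsub>W\<^esub>" and X: "X \<in> carrier (F V)"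
  shows "T W f X = \<zero>\<^bsub>F W\<^esub>"
proof -
  interpret W: Module.module k W by fact
  interpret FW: Module.module k "F W" by (rule F_module[OF W])
  have c: "T W f X \<in> carrier (F W)" by (rule linear_mapD(1)[OF T_linear[OF V W f] X])
  have "T W f X = T W (\<lambda>x. f x \<oplus>\<^bsub>W\<^esub> f x) X"
    by (rule T_cong[OF V W f linear_map_add[OF W f f] _ X]) (simp add: eq)
  also have "\<dots> = T W f X \<oplus>\<^bsub>F W\<^esub> T W f X" by (rule T_add[OF V W f f X])
  finally show ?thesis using c by (metis FW.add.r_cancel_one')
qed

lemma T_exact:
  assumes A: "Module.module k A" and B: "Module.module k B" and C: "Module.module k C"
    and f: "linear_map k A B f" and g: "linear_map k B C g"
    and ex: "f ` carrier A = {x \<in> carrier B. g x = \<zero>\<^bsub>C\<^esub>}"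
  shows "T B f ` carrier (F A) = {X \<in> carrier (F B). T C g X = \<zero>\<^bsub>F C\<^esub>}"
proof (intro equalityI subsetI)
  fix X assume "X \<in> T B f ` carrier (F A)"
  then obtain Y where Y: "Y \<in> carrier (F A)" "X = T B f Y" by blast
  have gf: "g (f x) = \<zero>\<^bsub>C\<^esub>" if "x \<in> carrier A" for x using ex that by blast
  have "T C g X = \<zero>\<^bsub>F C\<^esub>"
    using T_comp[OF A B C f g Y(1)] T_eq_zero[OF A C linear_map_comp[OF f g] gf Y(1)] Y(2) by simp
  then show "X \<in> {X \<in> carrier (F B). T C g X = \<zero>\<^bsub>F C\<^esub>}"
    using linear_mapD(1)[OF T_linear[OF A B f] Y(1)] Y(2) by simp
next
  fix X assume "X \<in> {X \<in> carrier (F B). T C g X = \<zero>\<^bsub>F C\<^esub>}"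
  then have X: "X \<in> carrier (F B)" and gX: "T C g X = \<zero>\<^bsub>F C\<^esub>" by auto
  interpret FB: Module.module k "F B" by (rule F_module[OF B])
  obtain p q where p: "linear_map k B A p" and q: "linear_map k C B q"
    and pq: "\<And>x. x \<in> carrier B \<Longrightarrow> f (p x) \<oplus>\<^bsub>B\<^esub> q (g x) = x"
    by (rule exact_pair_splits[OF field A B C f g ex]) (rule that)
  note fp = linear_map_comp[OF p f] and qg = linear_map_comp[OF g q]
  have pX: "T A p X \<in> carrier (F A)" by (rule linear_mapD(1)[OF T_linear[OF B A p] X])
  have "X = T B (\<lambda>x. f (p x) \<oplus>\<^bsub>B\<^esub> q (g x)) X"
    by (rule T_eq_id[OF B linear_map_add[OF B fp qg] pq X, symmetric])
  also have "\<dots> = T B (\<lambda>x. f (p x)) X \<oplus>\<^bsub>F B\<^esub> T B (\<lambda>x. q (g x)) X"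
    by (rule T_add[OF B B fp qg X])
  \<comment> \<open>The second summand factors through \<open>T C g X\<close>, which is zero; what
    remains exhibits \<open>T A p X\<close> as a preimage.\<close>
  also have "\<dots> = T B f (T A p X) \<oplus>\<^bsub>F B\<^esub> T B q \<zero>\<^bsub>F C\<^esub>"
    using T_comp[OF B A B p f X] T_comp[OF B C B g q X] gX by simp
  also have "\<dots> = T B f (T A p X)"
    using linear_map_zero[OF F_module[OF C] F_module[OF B] T_linear[OF C B q]]
      linear_mapD(1)[OF T_linear[OF A B f] pX] by simp
  finally show "X \<in> T B f ` carrier (F A)" using pX by blast
qed

text \<open>For injective \<open>f\<close>, cancelling \<open>f\<close> in f p f = f turns the
  generalized inverse into a left inverse.\<close>

lemma T_inj_on:
  assumes A: "Module.module k A" and B: "Module.module k B" and f: "linear_map k A B f"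
    and inj: "inj_on f (carrier A)"
  shows "inj_on (T B f) (carrier (F A))"
proof -
  obtain p where p: "linear_map k B A p" "\<And>x. x \<in> carrier A \<Longrightarrow> f (p (f x)) = f x"
    by (rule linear_generalized_inverse_exists[OF field A B f]) (rule that)
  have pf: "p (f x) = x" if "x \<in> carrier A" for x
    using inj_onD[OF inj p(2)[OF that]] linear_mapD(1)[OF p(1)] linear_mapD(1)[OF f] that by blast
  have "T A p (T B f X) = X" if "X \<in> carrier (F A)" for X
    using T_comp[OF A B A f p(1) that] T_eq_id[OF A linear_map_comp[OF f p(1)] pf that] by simp
  then show ?thesis by (rule inj_on_inverseI)
qed

text \<open>For surjective \<open>g\<close>, every vector of the target has the form g x, so g q g =
  g turns the generalized inverse into a right inverse.\<close>

lemma T_surj: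
  assumes B: "Module.module k B" and C: "Module.module k C" and g: "linear_map k B C g"
    and surj: "g ` carrier B = carrier C"
  shows "T C g ` carrier (F B) = carrier (F C)"
proof (intro equalityI subsetI)
  show "X \<in> carrier (F C)" if "X \<in> T C g ` carrier (F B)" for X
    using that linear_mapD(1)[OF T_linear[OF B C g]] by blast
  obtain q where q: "linear_map k C B q" "\<And>x. x \<in> carrier B \<Longrightarrow> g (q (g x)) = g x"
    by (rule linear_generalized_inverse_exists[OF field B C g]) (rule that)
  have gq: "g (q y) = y" if "y \<in> carrier C" for y
    using that q(2) unfolding surj[symmetric] by blast
  fix X assume X: "X \<in> carrier (F C)"
  have "T C g (T B q X) = X"
    using T_comp[OF C B C q(1) g X] T_eq_id[OF C linear_map_comp[OF q(1) g] gq X] by simp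
  then show "X \<in> T C g ` carrier (F B)"
    using linear_mapD(1)[OF T_linear[OF C B q(1)] X] by (metis image_eqI)
qed

end

lemma vector_space_functor_tensor_left:
  assumes k: "field k" and N: "Module.module k N"
  shows "vector_space_functor k (\<lambda>V. tensor_module k V N) (\<lambda>V f. tensor_map k V N f (\<lambda>y. y))"
  by (rule vector_space_functor.intro[OF k])
    \<comment> \<open>The axioms are the tensor laws with the identity in the second slot; the
      composite of two such identities beta-reduces to \<open>\<lambda>y. y\<close>, so the
      composition law has the required shape.\<close>
    (rule module_tensor_module[OF _ N] linear_map_tensor_map[OF _ N _ N _ linear_map_id]
      tensor_map_cong[OF _ N _ N _ linear_map_id _ linear_map_id _ refl]
      tensor_map_id[OF _ N] tensor_map_comp[OF _ N _ N _ N _ linear_map_id _ linear_map_id]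
      tensor_map_add_left[OF _ N _ N _ _ linear_map_id]; assumption | simp)+

lemma vector_space_functor_tensor_right:
  assumes k: "field k" and M: "Module.module k M"
  shows "vector_space_functor k (\<lambda>V. tensor_module k M V) (\<lambda>V f. tensor_map k M V (\<lambda>x. x) f)"
  by (rule vector_space_functor.intro[OF k])
    (rule module_tensor_module[OF M] linear_map_tensor_map[OF M _ M _ linear_map_id]
      tensor_map_cong[OF M _ M _ linear_map_id _ linear_map_id _ refl]
      tensor_map_id[OF M] tensor_map_comp[OF M _ M _ M _ linear_map_id _ linear_map_id]
      tensor_map_add_right[OF M _ M _ linear_map_id]; assumption | simp)+

section \<open>From stalks to persistence modules\<close>

text \<open>\<open>F\<close> and \<open>T\<close> depend on the point \<open>a\<close> because the
  fixed tensor factor enters through its stalk there. The functor equations hold stalk by stalk;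
  only \<open>pm\<close> and \<open>pmor\<close> involve the restriction maps, hence their role as
  hypotheses.\<close>

lemma additive_functor_stalkwise:
  fixes k :: "'k ring" and Fo :: "('i::order, 'k, 'u) pmod \<Rightarrow> ('i, 'k, 'w) pmod" and F T
  assumes T: "\<And>a. vector_space_functor k (F a) (T a)"
    and Fo: "\<And>A a. stalk (Fo A) a = F a (stalk A a)"
    and Fm: "\<And>A B f a. Fm A B f a = T a (stalk B a) (f a)"
    and pm: "\<And>A. persistence_module k A \<Longrightarrow> persistence_module k (Fo A)"
    and pmor: "\<And>A B f. persistence_module k A \<Longrightarrow> persistence_module k B \<Longrightarrow> pmorphism k A B f \<Longrightarrow>
      pmorphism k (Fo A) (Fo B) (Fm A B f)"
  shows "additive_functor k Fo Fm"
  unfolding additive_functor_def is_functor_def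
proof (intro conjI allI impI pm pmor; assumption?)
  note m = persistence_moduleD(1) and l = pmorphismD(1)
  fix A :: "('i, 'k, 'u) pmod"
  assume A: "persistence_module k A"
  show "pmorphism_eq (Fo A) (Fm A A pid) pid"
    unfolding pmorphism_eq_def Fo Fm pid_def
    by (intro allI ballI vector_space_functor.T_id[OF T m[OF A]])
  fix B :: "('i, 'k, 'u) pmod" and f
  assume B: "persistence_module k B" and f: "pmorphism k A B f"
  show "pmorphism_eq (Fo A) (Fm A C (pcomp g f)) (pcomp (Fm B C g) (Fm A B f))"
    if C: "persistence_module k C" and g: "pmorphism k B C g" for C g
    unfolding pmorphism_eq_def Fo Fm pcomp_def
    by (intro allI ballI vector_space_functor.T_comp[OF T m[OF A] m[OF B] m[OF C] l[OF f] l[OF g]])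
  fix g assume g: "pmorphism k A B g"
  show "pmorphism_eq (Fo A) (Fm A B (padd B f g)) (padd (Fo B) (Fm A B f) (Fm A B g))"
    unfolding pmorphism_eq_def Fo Fm padd_def
    by (intro allI ballI vector_space_functor.T_add[OF T m[OF A] m[OF B] l[OF f] l[OF g]])
  show "pmorphism_eq (Fo A) (Fm A B f) (Fm A B g)" if eq: "pmorphism_eq A f g"
    unfolding pmorphism_eq_def Fo Fm
    by (intro allI ballI vector_space_functor.T_cong[OF T m[OF A] m[OF B] l[OF f] l[OF g]])
      (use eq in \<open>simp_all add: pmorphism_eq_def\<close>)
qed

lemma exact_functor_stalkwise:
  fixes k :: "'k ring" and Fo :: "('i::order, 'k, 'u) pmod \<Rightarrow> ('i, 'k, 'w) pmod" and F T
  assumes add: "additive_functor k Fo Fm"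
    and T: "\<And>a. vector_space_functor k (F a) (T a)"
    and Fo: "\<And>A a. stalk (Fo A) a = F a (stalk A a)"
    and Fm: "\<And>A B f a. Fm A B f a = T a (stalk B a) (f a)"
  shows "exact_functor k Fo Fm"
  unfolding exact_functor_def
proof (intro conjI add allI impI)
  fix A :: "('i, 'k, 'u) pmod" and f and B :: "('i, 'k, 'u) pmod" and g and C :: "('i, 'k, 'u) pmod"
  assume s: "short_exact k A f B g C"
  then have P: "persistence_module k A" "persistence_module k B" "persistence_module k C"
    and f: "pmorphism k A B f" and g: "pmorphism k B C g"
    and ex: "pmono A f" "exact_at A f B g C" "pepi B C g"
    by (auto simp: short_exact_def)
  have "persistence_module k (Fo A)" "persistence_module k (Fo B)" "persistence_module k (Fo C)"
    "pmorphism k (Fo A) (Fo B) (Fm A B f)" "pmorphism k (Fo B) (Fo C) (Fm B C g)"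
    using add P f g unfolding additive_functor_def is_functor_def by auto
  moreover have "pmono (Fo A) (Fm A B f)"
    using ex(1) unfolding pmono_def Fo Fm
    by (auto intro!: vector_space_functor.T_inj_on[OF T] persistence_moduleD(1)[OF P(1)]
        persistence_moduleD(1)[OF P(2)] pmorphismD(1)[OF f])
  moreover have "exact_at (Fo A) (Fm A B f) (Fo B) (Fm B C g) (Fo C)"
    using ex(2) unfolding exact_at_def Fo Fm
    by (intro allI vector_space_functor.T_exact[OF T] persistence_moduleD(1)[OF P(1)]
        persistence_moduleD(1)[OF P(2)] persistence_moduleD(1)[OF P(3)]
        pmorphismD(1)[OF f] pmorphismD(1)[OF g]) simp
  moreover have "pepi (Fo B) (Fo C) (Fm B C g)"
    using ex(3) unfolding pepi_def Fo Fm
    by (intro allI vector_space_functor.T_surj[OF T] persistence_moduleD(1)[OF P(2)]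
        persistence_moduleD(1)[OF P(3)] pmorphismD(1)[OF g]) simp
  ultimately show "short_exact k (Fo A) (Fm A B f) (Fo B) (Fm B C g) (Fo C)"
    by (simp add: short_exact_def)
qed

text \<open>Every coset of the whole module is the module itself. This turns equality of cycles and
  boundaries into vanishing homology.\<close>

lemma quotient_module_self:
  assumes "Module.module k V"
  shows "carrier (quotient_module k V (carrier V)) = {\<zero>\<^bsub>quotient_module k V (carrier V)\<^esub>}"
proof -
  interpret Module.module k V by fact
  have "carrier V +>\<^bsub>V\<^esub> x = carrier V" if "x \<in> carrier V" for x
    using that by (intro a_coset_join2 submodule.axioms(1)[OF carrier_is_submodule])
  then show ?thesis
    unfolding quotient_module_simps(1,2)[OF assms carrier_is_submodule] by auto
qed

text \<open>In degree \<open>Suc j\<close> the resolution is exact at \<open>P (Suc j)\<close>, and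
  \<open>T_exact\<close> preserves this at each stalk, so every cycle is a boundary. In degree 0 all
  elements count as cycles and the augmentation is not part of the complex, hence the bound on
  \<open>i\<close>.\<close>

lemma left_derived_zero_stalkwise:
  assumes T: "\<And>a. vector_space_functor k (F a) (T a)"
    and Fo: "\<And>A a. stalk (Fo A) a = F a (stalk A a)"
    and Fm: "\<And>A B f a. Fm A B f a = T a (stalk B a) (f a)"
    and i: "i \<ge> 1" and H: "H \<in> left_derived k Fo Fm i M"
  shows "zero_pmod H"
proof -
  obtain j where j: "i = Suc j" using i by (cases i) auto
  obtain P d e where H: "H = homology k (\<lambda>j. Fo (P j)) (\<lambda>j. Fm (P (Suc j)) (P j) (d j)) (Suc j)"
    and P: "projective_resolution k P d e M"
    using H unfolding left_derived_def j by blast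
  have pm: "persistence_module k (P l)" and d: "pmorphism k (P (Suc l)) (P l) (d l)"
    and ex: "exact_at (P (Suc (Suc l))) (d (Suc l)) (P (Suc l)) (d l) (P l)" for l
    using P by (auto simp: projective_resolution_def projective_def)
  show ?thesis
    unfolding zero_pmod_def
  proof
    fix a
    interpret vector_space_functor k "F a" "T a" by (rule T)
    note m = persistence_moduleD(1)[OF pm, of _ a] and l = pmorphismD(1)[OF d, of _ a]
    let ?V = "stalk (Fo (P (Suc j))) a"
    let ?C = "cycles (\<lambda>j. Fo (P j)) (\<lambda>j. Fm (P (Suc j)) (P j) (d j)) (Suc j) a"
    let ?B = "boundaries (\<lambda>j. Fo (P j)) (\<lambda>j. Fm (P (Suc j)) (P j) (d j)) (Suc j) a"
    have B: "?B = ?C"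
      using T_exact[OF m m m l l] ex[of j]
      by (simp add: cycles_def boundaries_def exact_at_def Fo Fm)
    \<comment> \<open>\<open>homology\<close> shrinks the carrier to the cycles before dividing. By
      \<open>B\<close> this is a quotient by its own carrier, once the shrunken record is known to
      be a module.\<close>
    have "Module.module k ?V" unfolding Fo by (rule F_module[OF m])
    moreover have "submodule ?B k ?V"
      unfolding boundaries_def Fo Fm by (intro submodule_image T_linear F_module m l)
    ultimately have "Module.module k (?V\<lparr>carrier := ?B\<rparr>)"
      by (rule submodule.submodule_is_module[rotated])
    from quotient_module_self[OF this]
    show "carrier (stalk H a) = {\<zero>\<^bsub>stalk H a\<^esub>}"
      unfolding H homology_def using B by simp
  qed
qed

subsection \<open>The sheaf tensor product\<close>

text \<open>The laws for the restriction maps are the functor laws of the tensor product applied to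
  both factors; \<open>tensor_map_cong\<close> is needed because \<open>res\<close> obeys its laws
  only on the stalks.\<close>

lemma persistence_module_tensor:
  assumes M: "persistence_module k M" and N: "persistence_module k N"
  shows "persistence_module k (tensor_pmod k M N)"
proof -
  note MD = persistence_moduleD[OF M] and ND = persistence_moduleD[OF N]
  have S: "stalk (tensor_pmod k M N) a = tensor_module k (stalk M a) (stalk N a)"
    "res (tensor_pmod k M N) a b = tensor_map k (stalk M b) (stalk N b) (res M a b) (res N a b)" for a b
    by (simp_all add: tensor_pmod_def)
  show ?thesis
    unfolding persistence_module_def S
  proof (intro conjI allI impI ballI)
    show "Module.module k (tensor_module k (stalk M a) (stalk N a))" for a
      by (rule module_tensor_module[OF MD(1) ND(1)])
    show "linear_map k (tensor_module k (stalk M a) (stalk N a)) (tensor_module k (stalk M b) (stalk N b))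
        (tensor_map k (stalk M b) (stalk N b) (res M a b) (res N a b))" if "a \<le> b" for a b
      by (rule linear_map_tensor_map[OF MD(1) ND(1) MD(1) ND(1) MD(2)[OF that] ND(2)[OF that]])
    fix a X assume X: "X \<in> carrier (tensor_module k (stalk M a) (stalk N a))"
    note aa = order_refl[of a]
    show "tensor_map k (stalk M a) (stalk N a) (res M a a) (res N a a) X = X"
      using tensor_map_cong[OF MD(1) ND(1) MD(1) ND(1) MD(2)[OF aa] ND(2)[OF aa]
          linear_map_id linear_map_id MD(3) ND(3) X]
        tensor_map_id[OF MD(1) ND(1) X] by simp
    fix b c assume ab: "a \<le> b" and bc: "b \<le> c"
    note ac = order_trans[OF ab bc]
    show "tensor_map k (stalk M c) (stalk N c) (res M b c) (res N b c)
        (tensor_map k (stalk M b) (stalk N b) (res M a b) (res N a b) X) =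
        tensor_map k (stalk M c) (stalk N c) (res M a c) (res N a c) X"
      unfolding tensor_map_comp[OF MD(1) ND(1) MD(1) ND(1) MD(1) ND(1)
          MD(2)[OF ab] ND(2)[OF ab] MD(2)[OF bc] ND(2)[OF bc] X, symmetric]
      by (rule tensor_map_cong[OF MD(1) ND(1) MD(1) ND(1) linear_map_comp[OF MD(2)[OF ab] MD(2)[OF bc]]
          linear_map_comp[OF ND(2)[OF ab] ND(2)[OF bc]] MD(2)[OF ac] ND(2)[OF ac]
          MD(4)[OF ab bc] ND(4)[OF ab bc] X])
  qed
qed

text \<open>Both ways around the naturality square become tensors of composites, which agree factor
  by factor through the squares of \<open>f\<close> and \<open>g\<close>.\<close>

lemma pmorphism_tensor:
  assumes M: "persistence_module k M" and N: "persistence_module k N"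
    and M': "persistence_module k M'" and N': "persistence_module k N'"
    and f: "pmorphism k M M' f" and g: "pmorphism k N N' g"
  shows "pmorphism k (tensor_pmod k M N) (tensor_pmod k M' N') (tensor_pmor k M' N' f g)"
  unfolding pmorphism_def tensor_pmod_def tensor_pmor_def pmod.simps
proof (intro conjI allI impI ballI)
  note MD = persistence_moduleD[OF M] and ND = persistence_moduleD[OF N]
    and MD' = persistence_moduleD[OF M'] and ND' = persistence_moduleD[OF N']
    and fD = pmorphismD[OF f] and gD = pmorphismD[OF g]
  show "linear_map k (tensor_module k (stalk M a) (stalk N a)) (tensor_module k (stalk M' a) (stalk N' a))
      (tensor_map k (stalk M' a) (stalk N' a) (f a) (g a))" for a
    by (rule linear_map_tensor_map[OF MD(1) ND(1) MD'(1) ND'(1) fD(1) gD(1)])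
  fix a b X assume ab: "a \<le> b" and X: "X \<in> carrier (tensor_module k (stalk M a) (stalk N a))"
  show "tensor_map k (stalk M' b) (stalk N' b) (f b) (g b)
      (tensor_map k (stalk M b) (stalk N b) (res M a b) (res N a b) X) =
      tensor_map k (stalk M' b) (stalk N' b) (res M' a b) (res N' a b)
       (tensor_map k (stalk M' a) (stalk N' a) (f a) (g a) X)"
    unfolding tensor_map_comp[OF MD(1) ND(1) MD(1) ND(1) MD'(1) ND'(1)
        MD(2)[OF ab] ND(2)[OF ab] fD(1) gD(1) X, symmetric]
      tensor_map_comp[OF MD(1) ND(1) MD'(1) ND'(1) MD'(1) ND'(1)
        fD(1) gD(1) MD'(2)[OF ab] ND'(2)[OF ab] X, symmetric]
    by (rule tensor_map_cong[OF MD(1) ND(1) MD'(1) ND'(1)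
        linear_map_comp[OF MD(2)[OF ab] fD(1)] linear_map_comp[OF ND(2)[OF ab] gD(1)]
        linear_map_comp[OF fD(1) MD'(2)[OF ab]] linear_map_comp[OF gD(1) ND'(2)[OF ab]]
        fD(2)[OF ab] gD(2)[OF ab] X])
qed

lemma pmorphism_pid: "persistence_module k M \<Longrightarrow> pmorphism k M M pid"
  by (simp add: pmorphism_def pid_def linear_map_id)

lemma additive_functor_tensor:
  assumes k: "field k" and M: "persistence_module k M"
  shows "additive_functor k (\<lambda>A. tensor_pmod k A M) (\<lambda>A B f. tensor_pmor k B M f pid)"
    and "additive_functor k (\<lambda>A. tensor_pmod k M A) (\<lambda>A B f. tensor_pmor k M B pid f)"
proof -
  note MD = persistence_moduleD(1)[OF M]
  show "additive_functor k (\<lambda>A. tensor_pmod k A M) (\<lambda>A B f. tensor_pmor k B M f pid)"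
    by (rule additive_functor_stalkwise[OF vector_space_functor_tensor_left[OF k MD] _ _
          persistence_module_tensor[OF _ M] pmorphism_tensor[OF _ M _ M _ pmorphism_pid[OF M]]])
      (simp_all add: tensor_pmod_def tensor_pmor_def pid_def)
  show "additive_functor k (\<lambda>A. tensor_pmod k M A) (\<lambda>A B f. tensor_pmor k M B pid f)"
    by (rule additive_functor_stalkwise[OF vector_space_functor_tensor_right[OF k MD] _ _
          persistence_module_tensor[OF M] pmorphism_tensor[OF M _ M _ pmorphism_pid[OF M]]])
      (simp_all add: tensor_pmod_def tensor_pmor_def pid_def)
qed

text \<open>The vanishing covers every model in \<open>Tor\<close> and \<open>Tor'\<close>; by
  \<open>left_derived_nonempty\<close> these sets are inhabited when the resolved module has its
  stalks in \<open>universe\<close>.\<close>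

theorem theorem7p3:
  fixes k :: "'k ring"
  assumes "field k"
  shows "(\<forall>M :: (real ^ 'n, 'k, 'm) pmod. persistence_module k M \<longrightarrow>
            exact_functor k (\<lambda>A :: (real ^ 'n, 'k, 'u) pmod. tensor_pmod k A M)
              (\<lambda>A B f. tensor_pmor k B M f pid) \<and>
            exact_functor k (\<lambda>A :: (real ^ 'n, 'k, 'u) pmod. tensor_pmod k M A)
              (\<lambda>A B f. tensor_pmor k M B pid f)) \<and>
         (\<forall>(M :: (real ^ 'n, 'k, 'u) pmod) (N :: (real ^ 'n, 'k, 'v) pmod) i.
            persistence_module k M \<longrightarrow> persistence_module k N \<longrightarrow> i \<ge> 1 \<longrightarrow>
            (\<forall>T \<in> Tor k i M N \<union> Tor' k i M N. zero_pmod T))"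
proof -
  note L = vector_space_functor_tensor_left[OF assms persistence_moduleD(1)]
    and R = vector_space_functor_tensor_right[OF assms persistence_moduleD(1)]
  show ?thesis
  proof (intro conjI allI impI ballI)
    fix M :: "(real ^ 'n, 'k, 'm) pmod" assume M: "persistence_module k M"
    show "exact_functor k (\<lambda>A :: (real ^ 'n, 'k, 'u) pmod. tensor_pmod k A M)
        (\<lambda>A B f. tensor_pmor k B M f pid)"
      by (rule exact_functor_stalkwise[OF additive_functor_tensor(1)[OF assms M] L[OF M]])
        (simp_all add: tensor_pmod_def tensor_pmor_def pid_def)
    show "exact_functor k (\<lambda>A :: (real ^ 'n, 'k, 'u) pmod. tensor_pmod k M A)
        (\<lambda>A B f. tensor_pmor k M B pid f)"
      by (rule exact_functor_stalkwise[OF additive_functor_tensor(2)[OF assms M] R[OF M]])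
        (simp_all add: tensor_pmod_def tensor_pmor_def pid_def)
  next
    fix M :: "(real ^ 'n, 'k, 'u) pmod" and N :: "(real ^ 'n, 'k, 'v) pmod" and i :: nat and T
    assume M: "persistence_module k M" and N: "persistence_module k N" and i: "i \<ge> 1"
      and "T \<in> Tor k i M N \<union> Tor' k i M N"
    then consider "T \<in> Tor k i M N" | "T \<in> Tor' k i M N" by blast
    then show "zero_pmod T"
    proof cases
      case 1
      show ?thesis
        \<comment> \<open>\<open>Tor\<close> resolves the first argument, so the functor applied to
          the resolution keeps \<open>N\<close> fixed; \<open>Tor'\<close> reverses the
          roles.\<close>
        by (rule left_derived_zero_stalkwise[OF L[OF N] _ _ i 1[unfolded Tor_def]])
          (simp_all add: tensor_pmod_def tensor_pmor_def pid_def)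
    next
      case 2
      show ?thesis
        by (rule left_derived_zero_stalkwise[OF R[OF M] _ _ i 2[unfolded Tor'_def]])
          (simp_all add: tensor_pmod_def tensor_pmor_def pid_def)
    qed
  qed
qed

end
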